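(* Let $\mathbb{T}$ be a time scale, let $A,B\in\mathbb{T}$ with $A<B$, and let $[a,b]$, with $a,b\in\mathbb{T}$ and $b<B$, be a subinterval of $[A,B]$ (all intervals are time scale intervals). Let $H:\mathbb{R}^n\to\mathbb{R}$ and $P:\mathbb{R}^m\to\mathbb{R}$ have continuous partial derivatives $H'_i$, $i=1,\ldots,n$, and $P'_i$, $i=1,\ldots,m$, with respect to their arguments. Let $f_i$ ($i=1,\ldots,n$) and $g_j$ ($j=1,\ldots,m$) be functions of $(t,y,v)$ from $[a,b]\times\mathbb{R}^2$ to $\mathbb{R}$ having continuous partial derivatives $f_{iy},f_{iv}$ and $g_{jy},g_{jv}$ with respect to $y,v$ for all $t\in[a,b]$, and suppose that $f_i,f_{iy},f_{iv},g_j,g_{jy},g_{jv}$, evaluated at $(t,x^\sigma(t),x^\Delta(t))$, are rd-continuous in $t$ for all $x\in C^1_{rd}$. Put $$\mathcal{F}_i[x]=\int_a^b f_i(t,x^\sigma(t),x^\Delta(t))\,\Delta t,\qquad \mathcal{G}_j[x]=\int_a^b g_j(t,x^\sigma(t),x^\Delta(t))\,\Delta t .$$ Given real numbers $x_a,x_b,k$, consider the isoperimetric problem of minimizing or maximizing $\mathcal{L}[x]=H(\mathcal{F}_1[x],\ldots,\mathcal{F}_n[x])$ in the class of functions $x\in C^1_{rd}$ satisfying the boundary conditions $x(a)=x_a$, $x(b)=x_b$ and the constraint $\mathcal{K}[x]=P(\mathcal{G}_1[x],\ldots,\mathcal{G}_m[x])=k$. If $\tilde x$ is a normal extremizer for this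 problem, then there exists a real $\lambda$ such that $$\begin{aligned}&\sum_{i=1}^{n}H'_i(\mathcal{F}_1[\tilde x],\ldots,\mathcal{F}_n[\tilde x])\left(f_{iv}^\Delta(t,\tilde x^\sigma(t),\tilde x^\Delta(t))-f_{iy}(t,\tilde x^\sigma(t),\tilde x^\Delta(t))\right)\\&-\lambda\sum_{i=1}^{m}P'_i(\mathcal{G}_1[\tilde x],\ldots,\mathcal{G}_m[\tilde x])\left(g_{iv}^\Delta(t,\tilde x^\sigma(t),\tilde x^\Delta(t))-g_{iy}(t,\tilde x^\sigma(t),\tilde x^\Delta(t))\right)=0\end{aligned}$$ for all $t\in[a,b]^\kappa$.
   Context: A time scale $\mathbb{T}$ is a nonempty closed subset of $\mathbb{R}$ with the inherited topology; $[c,d]=\{t\in\mathbb{T}:c\le t\le d\}$. The jump operators are $\sigma(t)=\inf\{s\in\mathbb{T}:s>t\}$ (with $\sigma(M)=M$ if $M=\max\mathbb{T}$) and $\rho(t)=\sup\{s\in\mathbb{T}:s<t\}$ (with $\rho(m)=m$ if $m=\min\mathbb{T}$); $x^\sigma=x\circ\sigma$. A point $t$ is right-dense if $\sigma(t)=t$ and left-dense if $\rho(t)=t$. $\mathbb{T}^\kappa=\mathbb{T}\setminus(\rho(\sup\mathbb{T}),\sup\mathbb{T}]$ if $\sup\mathbb{T}<\infty$ and $\mathbb{T}^\kappa=\mathbb{T}$ otherwise; $[a,b]^\kappa$ is the same construction applied to $[a,b]$, i.e. $[a,b]\setminus(\rho(b),b]$. A function $f$ is delta differentiable at $t\in\mathbb{T}^\kappa$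 with delta derivative $f^\Delta(t)$ if for every $\varepsilon>0$ there is a neighborhood $U$ of $t$ in $\mathbb{T}$ with $|f(\sigma(t))-f(s)-f^\Delta(t)(\sigma(t)-s)|\le\varepsilon|\sigma(t)-s|$ for all $s\in U$. A function is rd-continuous if it is continuous at right-dense points and its left-sided limit exists at left-dense points. $C^1_{rd}$ is the set of delta differentiable functions with rd-continuous delta derivative. The delta integral is $\int_c^d g(t)\Delta t=G(d)-G(c)$ where $G^\Delta=g$ (such $G$ exists for rd-continuous $g$). $f_{iv}^\Delta(t,\tilde x^\sigma(t),\tilde x^\Delta(t))$ denotes the delta derivative of $t\mapsto f_{iv}(t,\tilde x^\sigma(t),\tilde x^\Delta(t))$, and similarly for $g_{iv}^\Delta$. Let $\|x\|_1=\sup_{t\in[a,b]}|x^\sigma(t)|+\sup_{t\in[a,b]}|x^\Delta(t)|$. An admissible function $\tilde x$ (one in $C^1_{rd}$ satisfying the boundary conditions and the constraint) is a weak local minimizer (respectively weak local maximizer) for the isoperimetric problem if there is $\delta>0$ such that $\mathcal{L}[\tilde x]\le\mathcal{L}[x]$ (respectively $\mathcal{L}[\tilde x]\ge\mathcal{L}[x]$) for all $x\in C^1_{rd}$ satisfying the boundary conditions, the constraint $\mathcal{K}[x]=k$, and $\|x-\tilde x\|_1<\delta$. An extremizer is a weak local minimizer or a weak local maximizer. $\tilde x$ is an extremal for $\mathcal{K}$ if $$\sum_{i=1}^{m}P'_i(\mathcal{G}_1[\tilde x],\ldots,\mathcal{G}_m[\tilde x])\left(g_{iv}(t,\tilde x^\sigma(t),\tilde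 x^\Delta(t))-\int_a^t g_{iy}(\tau,\tilde x^\sigma(\tau),\tilde x^\Delta(\tau))\Delta\tau\right)=c$$ for some constant $c$ and for all $t\in[a,b]$. An extremizer that is not an extremal for $\mathcal{K}$ is called normal; otherwise it is called abnormal.
   Formalization: Unless b is both left- and right-dense, t=b is dropped from the definition of extremal and the equation is not claimed at ρ(b) (or b); only the weighted sum, not each f_iv, g_iv, is shown delta differentiable; the partials' continuity in (y,v) is uniform in t. *)

theory Defs
  imports "HOL-Analysis.Analysis"
begin

text \<open>Functions on a time scale \<open>T\<close> are total functions on the reals; only their values on \<open>T\<close>
  are ever used.\<close>

definition time_scale :: "real set \<Rightarrow> bool" where
  "time_scale T \<longleftrightarrow> closed T \<and> T \<noteq> {}"

definition ts_interval :: "real set \<Rightarrow> real \<Rightarrow> real \<Rightarrow> real set" where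
  "ts_interval T c d = {t \<in> T. c \<le> t \<and> t \<le> d}"

definition forward_jump :: "real set \<Rightarrow> real \<Rightarrow> real" where
  "forward_jump T t = (if \<exists>s\<in>T. s > t then Inf {s \<in> T. s > t} else t)"

definition backward_jump :: "real set \<Rightarrow> real \<Rightarrow> real" where
  "backward_jump T t = (if \<exists>s\<in>T. s < t then Sup {s \<in> T. s < t} else t)"

definition kappa :: "real set \<Rightarrow> real set" where
  "kappa T = (if bdd_above T then T - {backward_jump T (Sup T)<..Sup T} else T)"

definition has_delta_derivative ::
    "real set \<Rightarrow> (real \<Rightarrow> real) \<Rightarrow> real \<Rightarrow> real \<Rightarrow> bool" where
  "has_delta_derivative T f D t \<longleftrightarrow> t \<in> kappa T \<and>
     (\<forall>\<epsilon>>0. \<exists>\<delta>>0. \<forall>s\<in>T. \<bar>s - t\<bar> < \<delta> \<longrightarrow>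
        \<bar>f (forward_jump T t) - f s - D * (forward_jump T t - s)\<bar> \<le> \<epsilon> * \<bar>forward_jump T t - s\<bar>)"

definition delta_differentiable :: "real set \<Rightarrow> (real \<Rightarrow> real) \<Rightarrow> real \<Rightarrow> bool" where
  "delta_differentiable T f t \<longleftrightarrow> (\<exists>D. has_delta_derivative T f D t)"

definition delta_deriv :: "real set \<Rightarrow> (real \<Rightarrow> real) \<Rightarrow> real \<Rightarrow> real" where
  "delta_deriv T f t = (THE D. has_delta_derivative T f D t)"

text \<open>Rd-continuity of a function defined on a part \<open>S\<close> of the time scale \<open>T\<close>. Density of a point
  refers to \<open>T\<close>, limits are taken inside the domain \<open>S\<close>.\<close>

definition rd_continuous_on :: "real set \<Rightarrow> real set \<Rightarrow> (real \<Rightarrow> real) \<Rightarrow> bool" where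
  "rd_continuous_on T S g \<longleftrightarrow> (\<forall>t\<in>S.
     (forward_jump T t = t \<longrightarrow> continuous (at t within S) g) \<and>
     (backward_jump T t = t \<longrightarrow> (\<exists>l. (g \<longlongrightarrow> l) (at t within S \<inter> {..<t}))))"

definition C1rd :: "real set \<Rightarrow> (real \<Rightarrow> real) set" where
  "C1rd T = {x. (\<forall>t \<in> kappa T. delta_differentiable T x t) \<and>
                rd_continuous_on T (kappa T) (delta_deriv T x)}"

text \<open>The increment \<open>G d - G c\<close> does not depend on the choice of the antiderivative \<open>G\<close> on
  \<open>[c,d]\<close>.\<close>

definition delta_integral :: "real set \<Rightarrow> real \<Rightarrow> real \<Rightarrow> (real \<Rightarrow> real) \<Rightarrow> real" where
  "delta_integral T c d g =
     (THE I. \<exists>G. (\<forall>t \<in> ts_interval T c d \<inter> kappa T. has_delta_derivative T G (g t) t)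
                 \<and> I = G d - G c)"

definition c1_norm :: "real set \<Rightarrow> real \<Rightarrow> real \<Rightarrow> (real \<Rightarrow> real) \<Rightarrow> real" where
  "c1_norm T a b x = (SUP t \<in> ts_interval T a b. \<bar>x (forward_jump T t)\<bar>)
                   + (SUP t \<in> ts_interval T a b. \<bar>delta_deriv T x t\<bar>)"

definition along :: "real set \<Rightarrow> (real \<Rightarrow> real) \<Rightarrow> (real \<Rightarrow> real \<Rightarrow> real \<Rightarrow> real) \<Rightarrow> real \<Rightarrow> real" where
  "along T x \<phi> t = \<phi> t (x (forward_jump T t)) (delta_deriv T x t)"

definition integral_functionals ::
    "real set \<Rightarrow> real \<Rightarrow> real \<Rightarrow> ('n \<Rightarrow> real \<Rightarrow> real \<Rightarrow> real \<Rightarrow> real) \<Rightarrow> (real \<Rightarrow> real) \<Rightarrow> real ^ 'n::finite" where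
  "integral_functionals T a b f x = (\<chi> i. delta_integral T a b (along T x (f i)))"

definition has_continuous_partials ::
    "(real ^ 'n::finite \<Rightarrow> real) \<Rightarrow> ('n \<Rightarrow> real ^ 'n \<Rightarrow> real) \<Rightarrow> bool" where
  "has_continuous_partials H H' \<longleftrightarrow> (\<forall>i.
     (\<forall>z. ((\<lambda>s. H (z + s *\<^sub>R axis i 1)) has_real_derivative H' i z) (at 0)) \<and>
     continuous_on UNIV (H' i))"

text \<open>Continuity in \<open>(y,v)\<close>, uniformly in the time variable. For compact \<open>S\<close> it follows from joint
  continuity in \<open>(t,y,v)\<close>, but it allows data that are only rd-continuous in \<open>t\<close>, such as
  \<open>h t * y\<close>. Continuity in \<open>(y,v)\<close> separately for each \<open>t\<close> would not suffice: it does not exclude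
  that \<open>\<phi>\<close> is unbounded near a point \<open>(t,y,v)\<close>.\<close>

definition continuous_uniformly_in_time ::
    "real set \<Rightarrow> (real \<Rightarrow> real \<Rightarrow> real \<Rightarrow> real) \<Rightarrow> bool" where
  "continuous_uniformly_in_time S \<phi> \<longleftrightarrow> (\<forall>y v. \<forall>\<epsilon>>0. \<exists>\<delta>>0. \<forall>t\<in>S. \<forall>y' v'.
     dist (y', v') (y, v) < \<delta> \<longrightarrow> \<bar>\<phi> t y' v' - \<phi> t y v\<bar> < \<epsilon>)"

definition regular_integrand ::
    "real set \<Rightarrow> real \<Rightarrow> real \<Rightarrow> (real \<Rightarrow> real \<Rightarrow> real \<Rightarrow> real) \<Rightarrow>
     (real \<Rightarrow> real \<Rightarrow> real \<Rightarrow> real) \<Rightarrow> (real \<Rightarrow> real \<Rightarrow> real \<Rightarrow> real) \<Rightarrow> bool" where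
  "regular_integrand T a b f fy fv \<longleftrightarrow>
     (\<forall>t \<in> ts_interval T a b. \<forall>y v.
        ((\<lambda>y. f t y v) has_real_derivative fy t y v) (at y) \<and>
        ((\<lambda>v. f t y v) has_real_derivative fv t y v) (at v)) \<and>
     continuous_uniformly_in_time (ts_interval T a b) fy \<and>
     continuous_uniformly_in_time (ts_interval T a b) fv \<and>
     (\<forall>x \<in> C1rd T. \<forall>\<phi> \<in> {f, fy, fv}. rd_continuous_on T (ts_interval T a b) (along T x \<phi>))"

definition admissible ::
    "real set \<Rightarrow> real \<Rightarrow> real \<Rightarrow> real \<Rightarrow> real \<Rightarrow> ((real \<Rightarrow> real) \<Rightarrow> real) \<Rightarrow> real \<Rightarrow> (real \<Rightarrow> real) \<Rightarrow> bool" where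
  "admissible T a b xa xb K k x \<longleftrightarrow> x \<in> C1rd T \<and> x a = xa \<and> x b = xb \<and> K x = k"

definition weak_local_minimizer ::
    "real set \<Rightarrow> real \<Rightarrow> real \<Rightarrow> real \<Rightarrow> real \<Rightarrow> ((real \<Rightarrow> real) \<Rightarrow> real) \<Rightarrow> real \<Rightarrow>
     ((real \<Rightarrow> real) \<Rightarrow> real) \<Rightarrow> (real \<Rightarrow> real) \<Rightarrow> bool" where
  "weak_local_minimizer T a b xa xb K k L xt \<longleftrightarrow> admissible T a b xa xb K k xt \<and>
     (\<exists>\<delta>>0. \<forall>x. admissible T a b xa xb K k x \<and> c1_norm T a b (\<lambda>t. x t - xt t) < \<delta> \<longrightarrow> L xt \<le> L x)"

definition weak_local_maximizer ::
    "real set \<Rightarrow> real \<Rightarrow> real \<Rightarrow> real \<Rightarrow> real \<Rightarrow> ((real \<Rightarrow> real) \<Rightarrow> real) \<Rightarrow> real \<Rightarrow>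
     ((real \<Rightarrow> real) \<Rightarrow> real) \<Rightarrow> (real \<Rightarrow> real) \<Rightarrow> bool" where
  "weak_local_maximizer T a b xa xb K k L xt \<longleftrightarrow> admissible T a b xa xb K k xt \<and>
     (\<exists>\<delta>>0. \<forall>x. admissible T a b xa xb K k x \<and> c1_norm T a b (\<lambda>t. x t - xt t) < \<delta> \<longrightarrow> L xt \<ge> L x)"

definition extremizer ::
    "real set \<Rightarrow> real \<Rightarrow> real \<Rightarrow> real \<Rightarrow> real \<Rightarrow> ((real \<Rightarrow> real) \<Rightarrow> real) \<Rightarrow> real \<Rightarrow>
     ((real \<Rightarrow> real) \<Rightarrow> real) \<Rightarrow> (real \<Rightarrow> real) \<Rightarrow> bool" where
  "extremizer T a b xa xb K k L xt \<longleftrightarrow>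
     weak_local_minimizer T a b xa xb K k L xt \<or> weak_local_maximizer T a b xa xb K k L xt"

text \<open>The points \<open>t\<close> of \<open>[a,b]\<close> at which \<open>x (forward_jump T t)\<close> and \<open>delta_deriv T x t\<close>, for
  \<open>x \<in> C1rd T\<close>, are determined by the restriction of \<open>x\<close> to \<open>[a,b]\<close>. This is all of \<open>[a,b]\<close> if \<open>b\<close>
  is left-dense and right-dense in \<open>T\<close>. Otherwise \<open>b\<close> is excluded, because the values there
  depend on \<open>x\<close> to the right of \<open>b\<close>, or (for \<open>b\<close> left-dense, right-scattered) are unrelated to
  the left-sided limits, while neither the functionals nor the boundary conditions see those
  values. With \<open>b\<close> included, changing \<open>x\<close> to the right of \<open>b\<close> would turn a minimizer that is an
  extremal for the constraint into one that is not.\<close>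

definition determined_points :: "real set \<Rightarrow> real \<Rightarrow> real \<Rightarrow> real set" where
  "determined_points T a b =
     {t \<in> ts_interval T a b. t < b \<or> (backward_jump T b = b \<and> forward_jump T b = b)}"

definition extremal_for ::
    "real set \<Rightarrow> real \<Rightarrow> real \<Rightarrow> ('m::finite \<Rightarrow> real ^ 'm \<Rightarrow> real) \<Rightarrow>
     ('m \<Rightarrow> real \<Rightarrow> real \<Rightarrow> real \<Rightarrow> real) \<Rightarrow> ('m \<Rightarrow> real \<Rightarrow> real \<Rightarrow> real \<Rightarrow> real) \<Rightarrow>
     ('m \<Rightarrow> real \<Rightarrow> real \<Rightarrow> real \<Rightarrow> real) \<Rightarrow> (real \<Rightarrow> real) \<Rightarrow> bool" where
  "extremal_for T a b P' g gy gv x \<longleftrightarrow> (\<exists>c. \<forall>t \<in> determined_points T a b.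
     (\<Sum>i\<in>UNIV. P' i (integral_functionals T a b g x) *
        (along T x (gv i) t - delta_integral T a t (along T x (gy i)))) = c)"

end

theory Submission imports Defs begin

text \<open>The calculus on \<open>[a,b]\<close> is reduced to integration over the real line: an rd-continuous
  \<open>\<phi>\<close>, extended as a constant from each point of the time scale over the gap to its right, is a
  regulated function of a real variable, and its indefinite integral is a delta antiderivative of
  \<open>\<phi>\<close>.

  Since \<open>xt\<close> is not an extremal for \<open>K\<close>, the du Bois-Reymond lemma yields a variation \<open>\<eta>2\<close>
  vanishing at \<open>a\<close> and \<open>b\<close> on which the first variation of \<open>K\<close> is nonzero. For any other such
  variation \<open>\<eta>\<close>, the functionals \<open>L\<close> and \<open>K\<close> restricted to \<open>xt + p\<^sub>1 \<eta> + p\<^sub>2 \<eta>2\<close> are functions in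
  the plane, and the Lagrange multiplier rule there shows that the first variation of \<open>L - mu K\<close>
  at \<open>xt\<close> vanishes on \<open>\<eta>\<close>, with \<open>mu\<close> determined by \<open>\<eta>2\<close>. The du Bois-Reymond lemma applied once
  more gives the Euler-Lagrange equation in integrated form.\<close>

section \<open>Regulated functions\<close>

text \<open>The competitors live on all of \<open>T\<close>, while the functionals see only
  \<open>[a,b]\<close>. A test function must therefore be delta differentiable with rd-continuous
  derivative beyond \<open>[a,b]\<close> as well, which shapes its construction as a primitive on
  the whole real line. At the right end the mismatch remains: integrals over \<open>[a,b]\<close> do
  not in general control what happens at \<open>b\<close>, so pointwise conclusions are drawn only
  on \<open>determined_points T a b\<close>.

  One parameter is not enough for the variations, since \<open>xt\<close> plus a multiple of
  \<open>\<eta>\<close> in general violates the constraint. The second parameter restores it, and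
  this is where normality is indispensable: the restoration works because the first variation of
  \<open>K\<close> along \<open>\<eta>2\<close> is nonzero. As \<open>\<eta>2\<close> is fixed
  before \<open>\<eta>\<close>, the quotient \<open>mu\<close> of the two first variations along
  \<open>\<eta>2\<close> serves all \<open>\<eta>\<close> at once, as the last use of the du
  Bois-Reymond lemma demands.\<close>

definition regulated :: "(real \<Rightarrow> real) \<Rightarrow> bool" where
  "regulated h \<longleftrightarrow> (\<forall>x. (\<exists>l. (h \<longlongrightarrow> l) (at_left x)) \<and> (\<exists>r. (h \<longlongrightarrow> r) (at_right x)))"

text \<open>The centre \<open>x\<close> is exempt: the value there is unrelated to the one-sided
  limits, and both uses of the lemma treat it separately.\<close>

lemma regulated_locally_step:
  assumes "regulated h" "e > 0"
  shows "\<exists>d>0. \<exists>l r. \<forall>y\<in>ball x d. (y < x \<longrightarrow> \<bar>h y - l\<bar> \<le> e) \<and> (x < y \<longrightarrow> \<bar>h y - r\<bar> \<le> e)"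
proof -
  obtain l r where l: "(h \<longlongrightarrow> l) (at_left x)" and r: "(h \<longlongrightarrow> r) (at_right x)"
    using assms unfolding regulated_def by blast
  have "\<forall>\<^sub>F y in at_left x. dist (h y) l < e" "\<forall>\<^sub>F y in at_right x. dist (h y) r < e"
    using l r assms(2) by (auto dest: tendstoD)
  then obtain u v where uv: "u < x" "\<And>y. u < y \<Longrightarrow> y < x \<Longrightarrow> dist (h y) l < e"
      "v > x" "\<And>y. x < y \<Longrightarrow> y < v \<Longrightarrow> dist (h y) r < e"
    unfolding eventually_at_left_field eventually_at_right_field by metis
  have "\<forall>y\<in>ball x (min (x - u) (v - x)).
      (y < x \<longrightarrow> \<bar>h y - l\<bar> \<le> e) \<and> (x < y \<longrightarrow> \<bar>h y - r\<bar> \<le> e)"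
    using uv(2,4) by (auto simp: dist_real_def less_imp_le)
  moreover have "min (x - u) (v - x) > 0" using uv by auto
  ultimately show ?thesis by blast
qed

lemma regulated_bounded:
  assumes "regulated h"
  shows "\<exists>M. \<forall>x\<in>{a..b}. \<bar>h x\<bar> \<le> M"
proof -
  have "\<exists>d>0. \<exists>M. \<forall>y\<in>ball x d. \<bar>h y\<bar> \<le> M" for x
  proof -
    obtain d l r where "d > 0"
      and d: "\<forall>y\<in>ball x d. (y < x \<longrightarrow> \<bar>h y - l\<bar> \<le> 1) \<and> (x < y \<longrightarrow> \<bar>h y - r\<bar> \<le> 1)"
      using regulated_locally_step[OF assms zero_less_one] by blast
    have "\<bar>h y\<bar> \<le> \<bar>l\<bar> + \<bar>r\<bar> + \<bar>h x\<bar> + 1" if "y \<in> ball x d" for y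
      using d[rule_format, OF that] by (cases y x rule: linorder_cases) auto
    with \<open>d > 0\<close> show ?thesis by blast
  qed
  then obtain d M where d: "\<And>x. d x > 0" and M: "\<And>x y. y \<in> ball x (d x) \<Longrightarrow> \<bar>h y\<bar> \<le> M x"
    by metis
  obtain C where C: "finite C" "{a..b} \<subseteq> (\<Union>x\<in>C. ball x (d x))"
    using compactE_image[of "{a..b}" "{a..b}" "\<lambda>x. ball x (d x)"] d
    by (metis (no_types, lifting) UN_I centre_in_ball compact_Icc open_ball subsetI)
  have "\<bar>h y\<bar> \<le> (\<Sum>x\<in>C. \<bar>M x\<bar>)" if y: "y \<in> {a..b}" for y
  proof -
    obtain x where "x \<in> C" "y \<in> ball x (d x)" using C y by blast
    then have "\<bar>h y\<bar> \<le> \<bar>M x\<bar>" using M by fastforce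
    also have "\<dots> \<le> (\<Sum>x\<in>C. \<bar>M x\<bar>)"
      using \<open>x \<in> C\<close> C(1) by (intro member_le_sum) auto
    finally show ?thesis .
  qed
  then show ?thesis by blast
qed

text \<open>On each cell of a sufficiently fine tagged division, \<open>h\<close> is within
  \<open>e\<close> of a function that is constant on either side of the tag. Glued together, these
  are integrable uniform approximations, and a uniform limit of integrable functions is
  integrable.\<close>

lemma regulated_integrable:
  assumes "regulated h"
  shows "h integrable_on {a..b}"
proof -
  have "\<exists>g. (\<forall>x\<in>cbox a b. norm (h x - g x) \<le> e) \<and> g integrable_on cbox a b" if "e > 0" for e
  proof -
    obtain d l r where d: "\<And>x. d x > 0"
      and lr: "\<And>x y. y \<in> ball x (d x) \<Longrightarrow> (y < x \<longrightarrow> \<bar>h y - l x\<bar> \<le> e) \<and> (x < y \<longrightarrow> \<bar>h y - r x\<bar> \<le> e)"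
      using regulated_locally_step[OF assms \<open>e > 0\<close>] by metis
    have "gauge (\<lambda>x. ball x (d x))"
      using d by (simp add: gauge_def)
    then obtain p where p: "p tagged_division_of cbox a b" "(\<lambda>x. ball x (d x)) fine p"
      using fine_division_exists by blast
    have *: "\<forall>i\<in>snd ` p. \<exists>g. (\<forall>y\<in>i. norm (h y - g y) \<le> e) \<and> g integrable_on i"
    proof clarify
      fix x K assume xK: "(x, K) \<in> p"
      obtain u v where K: "K = cbox u v" using p(1) xK by blast
      have "x \<in> K" using p(1) xK by blast
      then have x: "u \<le> x" "x \<le> v" by (auto simp: K)
      define g where "g y = (if y < x then l x else if y = x then h x else r x)" for y
      have 1: "g integrable_on {u..x}"
        by (rule integrable_spike_finite[of "{x}" _ _ "\<lambda>_. l x"]) (auto simp: g_def)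
      have 2: "g integrable_on {x..v}"
        by (rule integrable_spike_finite[of "{x}" _ _ "\<lambda>_. r x"]) (auto simp: g_def)
      have "g integrable_on K"
        using Henstock_Kurzweil_Integration.integrable_combine[OF x 1 2] by (simp add: K)
      moreover have "\<forall>y\<in>K. norm (h y - g y) \<le> e"
        using lr p(2) xK \<open>e > 0\<close> unfolding fine_def g_def by fastforce
      ultimately show "\<exists>g. (\<forall>y\<in>snd (x, K). norm (h y - g y) \<le> e) \<and> g integrable_on snd (x, K)"
        by auto
    qed
    show ?thesis
      using approximable_on_division[OF less_imp_le[OF \<open>e > 0\<close>] division_of_tagged_division[OF p(1)] *]
      by metis
  qed
  from integrable_uniform_limit[of a b h, OF this] show ?thesis by simp
qed

lemma regulated_primitive:
  assumes "regulated h"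
  obtains G where "\<And>u v. u \<le> v \<Longrightarrow> (h has_integral G v - G u) {u..v}"
proof
  \<comment> \<open>The integral from 0 to \<open>t\<close> with its orientation, so that a single
    \<open>G\<close> gives the increments on all intervals, on either side of 0.\<close>
  define G where "G t = (if 0 \<le> t then integral {0..t} h else - integral {t..0} h)" for t
  note int = regulated_integrable[OF assms]
  note comb = Henstock_Kurzweil_Integration.integral_combine[OF _ _ int]
  fix u v :: real assume "u \<le> v"
  have "integral {u..v} h = G v - G u"
    using comb[of 0 u v] comb[of u 0 v] comb[of u v 0] \<open>u \<le> v\<close> by (auto simp: G_def)
  with int[of u v] show "(h has_integral G v - G u) {u..v}"
    by (simp add: has_integral_integrable_integral)
qed

section \<open>Delta derivatives\<close>

lemma nonpos_if_le_small_multiple: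
  fixes x m :: real
  assumes "\<And>\<epsilon>. \<epsilon> > 0 \<Longrightarrow> x \<le> \<epsilon> * m" "m \<ge> 0"
  shows "x \<le> 0"
proof (rule field_le_epsilon)
  fix e :: real assume "e > 0"
  have "x \<le> e / (m + 1) * m" using \<open>e > 0\<close> assms(2) by (intro assms(1)) simp
  also have "\<dots> \<le> 0 + e" using \<open>e > 0\<close> assms(2) by (simp add: field_simps)
  finally show "x \<le> 0 + e" .
qed

lemma forward_jump_ge: "t \<le> forward_jump T t"
  unfolding forward_jump_def by (auto intro: cInf_greatest)

lemma forward_jump_le: "s \<in> T \<Longrightarrow> t < s \<Longrightarrow> forward_jump T t \<le> s"
  unfolding forward_jump_def by (auto intro!: cInf_lower bdd_belowI[of _ t])

lemma forward_jump_in: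
  assumes "closed T" "t \<in> T"
  shows "forward_jump T t \<in> T"
proof (cases "\<exists>s\<in>T. s > t")
  case True
  have "Inf {s\<in>T. s > t} \<in> closure {s\<in>T. s > t}"
    using True by (intro closure_contains_Inf) (auto intro!: bdd_belowI[of _ t])
  also have "\<dots> \<subseteq> T"
    by (rule closure_minimal) (use assms in auto)
  finally show ?thesis using True by (simp add: forward_jump_def)
qed (use assms in \<open>simp add: forward_jump_def\<close>)

text \<open>The point \<open>u\<close> rules out that \<open>t\<close> is the maximum of
  \<open>T\<close>, where \<open>forward_jump T t = t\<close> holds by convention and no point lies
  to the right.\<close>

lemma right_dense_approx:
  assumes "forward_jump T t = t" "u \<in> T" "t < u" "0 < d"
  obtains s where "s \<in> T" "t < s" "s < t + d"
proof -
  have "Inf {s\<in>T. s > t} < t + d"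
    using assms by (auto simp: forward_jump_def split: if_splits)
  then have "\<exists>s\<in>{s\<in>T. s > t}. s < t + d"
    using assms by (subst (asm) cInf_less_iff) (auto intro!: bdd_belowI[of _ t])
  then show ?thesis using that by auto
qed

lemma backward_jump_le: "backward_jump T t \<le> t"
  unfolding backward_jump_def by (auto intro: cSup_least)

lemma backward_jump_ge: "s \<in> T \<Longrightarrow> s < t \<Longrightarrow> s \<le> backward_jump T t"
  unfolding backward_jump_def by (auto intro!: cSup_upper bdd_aboveI[of _ t])

lemma left_dense_approx:
  assumes "backward_jump T t = t" "u \<in> T" "u < t" "0 < d"
  obtains s where "s \<in> T" "s < t" "t - d < s"
proof -
  have "t - d < Sup {s\<in>T. s < t}"
    using assms by (auto simp: backward_jump_def split: if_splits)
  then have "\<exists>s\<in>{s\<in>T. s < t}. t - d < s"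
    using assms by (subst (asm) less_cSup_iff) (auto intro!: bdd_aboveI[of _ t])
  then show ?thesis using that by auto
qed

lemma kappa_subset: "kappa T \<subseteq> T"
  by (auto simp: kappa_def)

lemma kappaI: "t \<in> T \<Longrightarrow> u \<in> T \<Longrightarrow> t < u \<Longrightarrow> t \<in> kappa T"
  using backward_jump_ge[of t T "Sup T"] cSup_upper[of u T] by (auto simp: kappa_def)

lemma has_delta_derivativeD:
  assumes "has_delta_derivative T f D t" "\<epsilon> > 0"
  obtains \<delta> where "\<delta> > 0" "\<And>s. s \<in> T \<Longrightarrow> \<bar>s - t\<bar> < \<delta> \<Longrightarrow>
    \<bar>f (forward_jump T t) - f s - D * (forward_jump T t - s)\<bar> \<le> \<epsilon> * \<bar>forward_jump T t - s\<bar>"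
  using assms unfolding has_delta_derivative_def by blast

lemma has_delta_derivative_kappa: "has_delta_derivative T f D t \<Longrightarrow> t \<in> kappa T"
  by (simp add: has_delta_derivative_def)

text \<open>The choice \<open>s = t\<close> in the definition bounds the defect by every positive
  multiple of the fixed number \<open>forward_jump T t - t\<close>, so the defect is zero.\<close>

lemma has_delta_derivative_jump:
  assumes "has_delta_derivative T f D t"
  shows "f (forward_jump T t) - f t = D * (forward_jump T t - t)"
proof -
  let ?r = "\<bar>f (forward_jump T t) - f t - D * (forward_jump T t - t)\<bar>"
  have "t \<in> T" using has_delta_derivative_kappa[OF assms] kappa_subset by blast
  have "?r \<le> \<epsilon> * (forward_jump T t - t)" if "\<epsilon> > 0" for \<epsilon>
    using has_delta_derivativeD[OF assms that] \<open>t \<in> T\<close> forward_jump_ge[of t T]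
    by (metis abs_of_nonneg abs_zero diff_ge_0_iff_ge diff_self)
  then have "?r \<le> 0" using forward_jump_ge[of t T] by (intro nonpos_if_le_small_multiple) auto
  then show ?thesis by simp
qed

lemma has_delta_derivative_lincomb:
  assumes "has_delta_derivative T f D t" "has_delta_derivative T g E t"
  shows "has_delta_derivative T (\<lambda>s. c * f s + d * g s) (c * D + d * E) t"
  unfolding has_delta_derivative_def
proof (intro conjI allI impI)
  show "t \<in> kappa T" using assms by (simp add: has_delta_derivative_def)
  fix \<epsilon> :: real assume "\<epsilon> > 0"
  define \<eta> where "\<eta> = \<epsilon> / (\<bar>c\<bar> + \<bar>d\<bar> + 1)"
  have "\<eta> > 0" "(\<bar>c\<bar> + \<bar>d\<bar>) * \<eta> \<le> \<epsilon>"
    using \<open>\<epsilon> > 0\<close> by (auto simp: \<eta>_def field_simps intro!: divide_pos_pos)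
  let ?j = "forward_jump T t"
  obtain \<delta>1 \<delta>2 where \<delta>: "\<delta>1 > 0" "\<delta>2 > 0"
    "\<And>s. s \<in> T \<Longrightarrow> \<bar>s - t\<bar> < \<delta>1 \<Longrightarrow> \<bar>f ?j - f s - D * (?j - s)\<bar> \<le> \<eta> * \<bar>?j - s\<bar>"
    "\<And>s. s \<in> T \<Longrightarrow> \<bar>s - t\<bar> < \<delta>2 \<Longrightarrow> \<bar>g ?j - g s - E * (?j - s)\<bar> \<le> \<eta> * \<bar>?j - s\<bar>"
    using has_delta_derivativeD[OF assms(1) \<open>\<eta> > 0\<close>] has_delta_derivativeD[OF assms(2) \<open>\<eta> > 0\<close>]
    by metis
  show "\<exists>\<delta>>0. \<forall>s\<in>T. \<bar>s - t\<bar> < \<delta> \<longrightarrow> \<bar>c * f ?j + d * g ?j - (c * f s + d * g s)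
      - (c * D + d * E) * (?j - s)\<bar> \<le> \<epsilon> * \<bar>?j - s\<bar>"
  proof (intro exI[of _ "min \<delta>1 \<delta>2"] conjI ballI impI)
    fix s assume s: "s \<in> T" "\<bar>s - t\<bar> < min \<delta>1 \<delta>2"
    let ?F = "f ?j - f s - D * (?j - s)" and ?G = "g ?j - g s - E * (?j - s)"
    have "c * f ?j + d * g ?j - (c * f s + d * g s) - (c * D + d * E) * (?j - s) = c * ?F + d * ?G"
      by (simp add: algebra_simps)
    also have "\<bar>\<dots>\<bar> \<le> \<bar>c\<bar> * \<bar>?F\<bar> + \<bar>d\<bar> * \<bar>?G\<bar>"
      by (metis abs_mult abs_triangle_ineq)
    also have "\<dots> \<le> \<bar>c\<bar> * (\<eta> * \<bar>?j - s\<bar>) + \<bar>d\<bar> * (\<eta> * \<bar>?j - s\<bar>)"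
      using \<delta> s by (intro add_mono mult_left_mono) auto
    also have "\<dots> = ((\<bar>c\<bar> + \<bar>d\<bar>) * \<eta>) * \<bar>?j - s\<bar>" by (simp add: algebra_simps)
    also have "\<dots> \<le> \<epsilon> * \<bar>?j - s\<bar>"
      by (intro mult_right_mono) (fact, simp)
    finally show "\<bar>c * f ?j + d * g ?j - (c * f s + d * g s) - (c * D + d * E) * (?j - s)\<bar>
        \<le> \<epsilon> * \<bar>?j - s\<bar>" .
  qed (use \<delta> in auto)
qed

lemma has_delta_derivative_const: "t \<in> kappa T \<Longrightarrow> has_delta_derivative T (\<lambda>_. c) 0 t"
  by (auto simp: has_delta_derivative_def intro: exI[of _ 1])

lemma has_delta_derivative_sum:
  assumes "t \<in> kappa T" "\<And>i. i \<in> I \<Longrightarrow> has_delta_derivative T (f i) (D i) t"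
  shows "has_delta_derivative T (\<lambda>s. \<Sum>i\<in>I. c i * f i s) (\<Sum>i\<in>I. c i * D i) t"
  using assms(2)
proof (induction I rule: infinite_finite_induct)
  case (insert i I)
  then show ?case
    using has_delta_derivative_lincomb[of T "f i" "D i" t _ _ "c i" 1] by simp
qed (use has_delta_derivative_const[OF assms(1)] in auto)

lemma has_delta_derivative_continuous:
  assumes "has_delta_derivative T f D t"
  shows "continuous (at t within T) f"
  unfolding continuous_within_eps_delta
proof (intro allI impI)
  fix e :: real assume "e > 0"
  let ?j = "forward_jump T t"
  define \<mu> where "\<mu> = ?j - t"
  have "\<mu> \<ge> 0" using forward_jump_ge by (simp add: \<mu>_def)
  \<comment> \<open>For \<open>s\<close> within distance 1 of \<open>t\<close>, the distance
    \<open>\<bar>?j - s\<bar>\<close> is at most \<open>\<mu> + 1\<close>, so the defect is at most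
    \<open>e / 2\<close>; the other half of \<open>e\<close> is for
    \<open>D * (s - t)\<close>.\<close>
  define \<epsilon> where "\<epsilon> = e / 2 / (\<mu> + 1)"
  have "\<epsilon> > 0" using \<open>e > 0\<close> \<open>\<mu> \<ge> 0\<close> by (simp add: \<epsilon>_def)
  have "\<mu> + 1 \<noteq> 0" using \<open>\<mu> \<ge> 0\<close> by simp
  then have "\<epsilon> * (\<mu> + 1) = e / 2" by (metis \<epsilon>_def eq_divide_eq)
  obtain \<delta> where \<delta>: "\<delta> > 0"
    "\<And>s. s \<in> T \<Longrightarrow> \<bar>s - t\<bar> < \<delta> \<Longrightarrow> \<bar>f ?j - f s - D * (?j - s)\<bar> \<le> \<epsilon> * \<bar>?j - s\<bar>"
    using has_delta_derivativeD[OF assms \<open>\<epsilon> > 0\<close>] by metis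
  define d where "d = min (min \<delta> 1) (e / (2 * (\<bar>D\<bar> + 1)))"
  have d: "d > 0" "d \<le> \<delta>" "d \<le> 1" "d * \<bar>D\<bar> < e / 2"
  proof -
    show "d > 0" using \<delta> \<open>e > 0\<close> by (auto simp: d_def)
    have "d * \<bar>D\<bar> \<le> (e / (2 * (\<bar>D\<bar> + 1))) * \<bar>D\<bar>" by (intro mult_right_mono) (auto simp: d_def)
    also have "\<dots> < e / 2" using \<open>e > 0\<close> by (simp add: field_simps add_nonneg_pos)
    finally show "d * \<bar>D\<bar> < e / 2" .
  qed (auto simp: d_def)
  show "\<exists>d>0. \<forall>s\<in>T. dist s t < d \<longrightarrow> dist (f s) (f t) < e"
  proof (intro exI[of _ d] conjI ballI impI)
    fix s assume s: "s \<in> T" "dist s t < d"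
    have "\<bar>f ?j - f s - D * (?j - s)\<bar> \<le> \<epsilon> * \<bar>?j - s\<bar>"
      using s d by (intro \<delta>) (auto simp: dist_real_def)
    also have "\<dots> \<le> \<epsilon> * (\<mu> + 1)"
      using s d \<open>\<epsilon> > 0\<close> forward_jump_ge[of t T]
      by (intro mult_left_mono) (auto simp: dist_real_def \<mu>_def)
    finally have 1: "\<bar>f ?j - f s - D * (?j - s)\<bar> \<le> e / 2" using \<open>\<epsilon> * (\<mu> + 1) = e / 2\<close> by simp
    have "f s - f t = D * (s - t) - (f ?j - f s - D * (?j - s))"
      using has_delta_derivative_jump[OF assms] by (simp add: algebra_simps)
    also have "\<bar>\<dots>\<bar> \<le> \<bar>D * (s - t)\<bar> + e / 2" using 1 by linarith
    also have "\<bar>D * (s - t)\<bar> \<le> d * \<bar>D\<bar>"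
      using s by (simp add: abs_mult dist_real_def mult.commute[of d] mult_left_mono)
    also have "d * \<bar>D\<bar> + e / 2 < e" using d by linarith
    finally show "dist (f s) (f t) < e" by (simp add: dist_real_def)
  qed (fact d)
qed

text \<open>Of the two asymmetric forms of the product rule, this one has the second factor at the
  jump. With a test function as second factor it produces the integrand of a first variation, which
  serves as integration by parts in \<open>du_Bois_Reymond\<close>.\<close>

lemma has_delta_derivative_mult:
  assumes f: "has_delta_derivative T f D t" and g: "has_delta_derivative T g E t"
  shows "has_delta_derivative T (\<lambda>s. f s * g s) (D * g (forward_jump T t) + f t * E) t"
  unfolding has_delta_derivative_def
proof (intro conjI allI impI)
  show "t \<in> kappa T" using f by (simp add: has_delta_derivative_def)
  fix \<epsilon> :: real assume "\<epsilon> > 0"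
  let ?j = "forward_jump T t"
  \<comment> \<open>\<open>C\<close> collects the factors of the three error terms below;
    \<open>\<bar>f t\<bar> + 1\<close> bounds \<open>\<bar>f s\<bar>\<close> because
    \<open>\<eta> \<le> 1\<close>.\<close>
  define C where "C = \<bar>g ?j\<bar> + \<bar>f t\<bar> + 1 + \<bar>E\<bar>"
  have "C > 0" by (simp add: C_def)
  define \<eta> where "\<eta> = min 1 (\<epsilon> / C)"
  have \<eta>: "\<eta> > 0" "\<eta> \<le> 1" "\<eta> * C \<le> \<epsilon>"
    using \<open>\<epsilon> > 0\<close> \<open>C > 0\<close> by (auto simp: \<eta>_def min_def field_simps)
  obtain \<delta>1 \<delta>2 where \<delta>: "\<delta>1 > 0" "\<delta>2 > 0"
    "\<And>s. s \<in> T \<Longrightarrow> \<bar>s - t\<bar> < \<delta>1 \<Longrightarrow> \<bar>f ?j - f s - D * (?j - s)\<bar> \<le> \<eta> * \<bar>?j - s\<bar>"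
    "\<And>s. s \<in> T \<Longrightarrow> \<bar>s - t\<bar> < \<delta>2 \<Longrightarrow> \<bar>g ?j - g s - E * (?j - s)\<bar> \<le> \<eta> * \<bar>?j - s\<bar>"
    using has_delta_derivativeD[OF f \<open>\<eta> > 0\<close>] has_delta_derivativeD[OF g \<open>\<eta> > 0\<close>]
    by metis
  obtain \<delta>3 where \<delta>3: "\<delta>3 > 0" "\<And>s. s \<in> T \<Longrightarrow> \<bar>s - t\<bar> < \<delta>3 \<Longrightarrow> \<bar>f s - f t\<bar> < \<eta>"
    using has_delta_derivative_continuous[OF f] \<eta>(1)
    unfolding continuous_within_eps_delta dist_real_def by metis
  show "\<exists>\<delta>>0. \<forall>s\<in>T. \<bar>s - t\<bar> < \<delta> \<longrightarrow> \<bar>f ?j * g ?j - f s * g s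
      - (D * g ?j + f t * E) * (?j - s)\<bar> \<le> \<epsilon> * \<bar>?j - s\<bar>"
  proof (intro exI[of _ "min (min \<delta>1 \<delta>2) \<delta>3"] conjI ballI impI)
    fix s assume s: "s \<in> T" "\<bar>s - t\<bar> < min (min \<delta>1 \<delta>2) \<delta>3"
    let ?F = "f ?j - f s - D * (?j - s)" and ?G = "g ?j - g s - E * (?j - s)"
    have F: "\<bar>?F\<bar> \<le> \<eta> * \<bar>?j - s\<bar>" and G: "\<bar>?G\<bar> \<le> \<eta> * \<bar>?j - s\<bar>" and fs: "\<bar>f s - f t\<bar> \<le> \<eta>"
      using s \<delta> \<delta>3 by (auto simp: less_imp_le)
    have "f ?j * g ?j - f s * g s - (D * g ?j + f t * E) * (?j - s)
        = ?F * g ?j + f s * ?G + (f s - f t) * (E * (?j - s))"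
      by (simp add: algebra_simps)
    also have "\<bar>\<dots>\<bar> \<le> \<bar>?F\<bar> * \<bar>g ?j\<bar> + \<bar>f s\<bar> * \<bar>?G\<bar> + \<bar>f s - f t\<bar> * (\<bar>E\<bar> * \<bar>?j - s\<bar>)"
      unfolding abs_mult[symmetric] by linarith
    also have "\<dots> \<le> (\<eta> * \<bar>?j - s\<bar>) * \<bar>g ?j\<bar> + (\<bar>f t\<bar> + 1) * (\<eta> * \<bar>?j - s\<bar>) + \<eta> * (\<bar>E\<bar> * \<bar>?j - s\<bar>)"
      using F G fs \<eta> by (intro add_mono mult_mono) auto
    also have "\<dots> = (\<eta> * C) * \<bar>?j - s\<bar>" by (simp add: C_def algebra_simps)
    also have "\<dots> \<le> \<epsilon> * \<bar>?j - s\<bar>" by (intro mult_right_mono \<eta>) simp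
    finally show "\<bar>f ?j * g ?j - f s * g s - (D * g ?j + f t * E) * (?j - s)\<bar> \<le> \<epsilon> * \<bar>?j - s\<bar>" .
  qed (use \<delta> \<delta>3 in auto)
qed

text \<open>The approximating points lie to the right unless \<open>t\<close> is the maximum of
  \<open>T\<close>; in that case membership in \<open>kappa T\<close> forces \<open>t\<close> to be
  left-dense, and they lie to the left.\<close>

lemma kappa_right_dense_approx:
  assumes "closed T" "t \<in> kappa T" "u \<in> T" "u \<noteq> t" "forward_jump T t = t" "d > 0"
  obtains s where "s \<in> T" "s \<noteq> t" "\<bar>s - t\<bar> < d"
proof (cases "\<exists>v\<in>T. t < v")
  case True
  then show ?thesis
    using right_dense_approx[OF assms(5) _ _ assms(6)] that
    by (metis abs_of_pos diff_gt_0_iff_gt less_irrefl less_diff_eq diff_less_eq add.commute)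
next
  case False
  have "t \<in> T" using assms(2) kappa_subset by blast
  have "u < t" using False assms(3,4) by (meson linorder_neqE)
  have "Sup T = t" using False \<open>t \<in> T\<close> by (intro cSup_eq_maximum) (auto simp: not_less)
  moreover have "bdd_above T" using False by (auto simp: not_less intro: bdd_aboveI)
  ultimately have "backward_jump T t = t"
    using assms(2) backward_jump_le[of T t] by (auto simp: kappa_def)
  from left_dense_approx[OF this assms(3) \<open>u < t\<close> assms(6)] obtain s where
    "s \<in> T" "s < t" "t - d < s" .
  then show ?thesis using that[of s] by auto
qed

text \<open>The two distinct points \<open>u\<close> and \<open>v\<close> exclude a one-point time
  scale, on which every number is a delta derivative. At a right-scattered point the difference
  quotient over the jump fixes the value; at a right-dense point other points of \<open>T\<close>
  come arbitrarily close.\<close>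

lemma has_delta_derivative_unique:
  assumes "closed T" "u \<in> T" "v \<in> T" "u \<noteq> v"
    and "has_delta_derivative T f D t" "has_delta_derivative T f E t"
  shows "D = E"
proof (cases "forward_jump T t = t")
  case False
  then show ?thesis
    using has_delta_derivative_jump[OF assms(5)] has_delta_derivative_jump[OF assms(6)] by simp
next
  case True
  obtain w where w: "w \<in> T" "w \<noteq> t" using assms(2-4) by metis
  show ?thesis
  proof (rule ccontr)
    assume "D \<noteq> E"
    define \<epsilon> where "\<epsilon> = \<bar>D - E\<bar> / 3"
    have "\<epsilon> > 0" using \<open>D \<noteq> E\<close> by (simp add: \<epsilon>_def)
    obtain \<delta>1 \<delta>2 where \<delta>: "\<delta>1 > 0" "\<delta>2 > 0"
      "\<And>s. s \<in> T \<Longrightarrow> \<bar>s - t\<bar> < \<delta>1 \<Longrightarrow> \<bar>f t - f s - D * (t - s)\<bar> \<le> \<epsilon> * \<bar>t - s\<bar>"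
      "\<And>s. s \<in> T \<Longrightarrow> \<bar>s - t\<bar> < \<delta>2 \<Longrightarrow> \<bar>f t - f s - E * (t - s)\<bar> \<le> \<epsilon> * \<bar>t - s\<bar>"
      using has_delta_derivativeD[OF assms(5) \<open>\<epsilon> > 0\<close>] has_delta_derivativeD[OF assms(6) \<open>\<epsilon> > 0\<close>]
      unfolding True by metis
    obtain s where s: "s \<in> T" "s \<noteq> t" "\<bar>s - t\<bar> < min \<delta>1 \<delta>2"
      using kappa_right_dense_approx[OF assms(1) _ w True, of "min \<delta>1 \<delta>2"] \<delta>(1,2)
        has_delta_derivative_kappa[OF assms(5)] by (metis min_less_iff_conj)
    have "\<bar>(D - E) * (t - s)\<bar> \<le> 2 * \<epsilon> * \<bar>t - s\<bar>"
      using \<delta>(3,4)[OF s(1)] s(3) by (auto simp: algebra_simps abs_le_iff)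
    then have "\<bar>D - E\<bar> \<le> 2 * \<epsilon>" using s by (simp add: abs_mult)
    then show False using \<open>\<epsilon> > 0\<close> by (simp add: \<epsilon>_def)
  qed
qed

lemma delta_deriv_eq:
  assumes "closed T" "u \<in> T" "v \<in> T" "u \<noteq> v" "has_delta_derivative T f D t"
  shows "delta_deriv T f t = D"
  unfolding delta_deriv_def
  using assms has_delta_derivative_unique by (intro the_equality) blast+

text \<open>The infimum \<open>m\<close> of the counterexamples lies in \<open>T\<close> by
  closedness. One of \<open>base\<close>, \<open>left\<close> and \<open>scattered\<close> gives
  \<open>P m\<close>; then \<open>right\<close>, or the gap after \<open>m\<close>, keeps the
  counterexamples away from \<open>m\<close>, against the choice of \<open>m\<close>.\<close>

lemma time_scale_induct:
  assumes "closed T" "c \<in> T" "c \<le> d" and base: "P c"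
    and scattered: "\<And>t. t \<in> T \<Longrightarrow> c \<le> t \<Longrightarrow> t < forward_jump T t \<Longrightarrow> forward_jump T t \<le> d \<Longrightarrow> P t
      \<Longrightarrow> P (forward_jump T t)"
    and right: "\<And>t. t \<in> T \<Longrightarrow> c \<le> t \<Longrightarrow> t < d \<Longrightarrow> forward_jump T t = t \<Longrightarrow> P t
      \<Longrightarrow> \<exists>\<delta>>0. \<forall>s\<in>T. t < s \<and> s < t + \<delta> \<and> s \<le> d \<longrightarrow> P s"
    and left: "\<And>t. t \<in> T \<Longrightarrow> c < t \<Longrightarrow> t \<le> d \<Longrightarrow> backward_jump T t = t
      \<Longrightarrow> (\<And>s. s \<in> T \<Longrightarrow> c \<le> s \<Longrightarrow> s < t \<Longrightarrow> P s) \<Longrightarrow> P t"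
    and t: "t \<in> ts_interval T c d"
  shows "P t"
proof (rule ccontr)
  assume "\<not> P t"
  define F where "F = {s \<in> ts_interval T c d. \<not> P s}"
  define m where "m = Inf F"
  have F: "F \<noteq> {}" "bdd_below F"
    using t \<open>\<not> P t\<close> by (auto simp: F_def ts_interval_def)
  have FT: "F \<subseteq> T \<inter> {c..d}" by (auto simp: F_def ts_interval_def)
  have "m \<in> closure F" unfolding m_def using F by (rule closure_contains_Inf)
  also have "closure F \<subseteq> T \<inter> {c..d}"
    by (rule closure_minimal[OF FT]) (use assms(1) in auto)
  finally have m: "m \<in> T" "c \<le> m" "m \<le> d" by auto
  have below: "P s" if "s \<in> T" "c \<le> s" "s < m" for s
  proof (rule ccontr)
    assume "\<not> P s"
    then have "s \<in> F" using that m by (auto simp: F_def ts_interval_def)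
    then have "m \<le> s" unfolding m_def using F by (intro cInf_lower)
    then show False using that by simp
  qed
  have "P m"
  proof (cases "m = c")
    case False
    then have "c < m" using m by simp
    show ?thesis
    proof (cases "backward_jump T m = m")
      case True
      then show ?thesis using left m \<open>c < m\<close> below by blast
    next
      \<comment> \<open>A left-scattered \<open>m\<close> is the forward jump of its predecessor
        \<open>r\<close>, and \<open>r < m\<close> is no counterexample, so \<open>scattered\<close>
        applies.\<close>
      case scat: False
      define r where "r = backward_jump T m"
      have r: "r < m" "c \<le> r"
        using scat backward_jump_le[of T m] backward_jump_ge[OF assms(2) \<open>c < m\<close>] by (auto simp: r_def)
      have "r \<in> closure {s\<in>T. s < m}"
      proof -
        have "r = Sup {s\<in>T. s < m}"
          using \<open>c < m\<close> assms(2) by (auto simp: r_def backward_jump_def)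
        then show ?thesis
          using \<open>c < m\<close> assms(2) by (auto intro!: closure_contains_Sup bdd_aboveI[of _ m])
      qed
      also have "\<dots> \<subseteq> T" by (rule closure_minimal) (use assms(1) in auto)
      finally have "r \<in> T" .
      have "forward_jump T r = m"
      proof (rule antisym)
        show "forward_jump T r \<le> m" by (rule forward_jump_le) (use m r in auto)
        show "m \<le> forward_jump T r"
          unfolding forward_jump_def using m(1) r(1) backward_jump_ge[of _ T m]
          by (auto simp: r_def intro!: cInf_greatest) (metis not_le)
      qed
      then show ?thesis
        using scattered[of r] r \<open>r \<in> T\<close> below m by simp
    qed
  qed (use base in simp)
  obtain u where u: "u \<in> F" using F by blast
  have "m \<notin> F" using \<open>P m\<close> by (simp add: F_def)
  have Fge: "m < s" if "s \<in> F" for s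
    using cInf_lower[OF that F(2)] \<open>m \<notin> F\<close> that by (metis m_def order_le_less)
  have "m < d" using Fge[OF u] FT u by auto
  show False
  proof (cases "forward_jump T m = m")
    case True
    then obtain \<delta> where \<delta>: "\<delta> > 0" "\<forall>s\<in>T. m < s \<and> s < m + \<delta> \<and> s \<le> d \<longrightarrow> P s"
      using right m \<open>m < d\<close> \<open>P m\<close> by blast
    obtain s where "s \<in> F" "s < m + \<delta>"
      using cInf_lessD[of F "m + \<delta>"] F \<delta>(1) by (auto simp: m_def)
    then show False using \<delta>(2) Fge FT by (auto simp: F_def ts_interval_def)
  next
    case False
    then have j: "m < forward_jump T m" using forward_jump_ge[of m T] by simp
    have ge: "forward_jump T m \<le> s" if "s \<in> F" for s
      using forward_jump_le Fge FT that by blast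
    then have "forward_jump T m \<le> m" unfolding m_def using F by (intro cInf_greatest) auto
    then show False using j by simp
  qed
qed

text \<open>Constancy itself does not pass through a right-dense point, where a zero derivative
  gives only a bound by a small multiple of the distance. The bound
  \<open>\<epsilon> * (t - c)\<close> passes through all steps of the induction, and
  \<open>\<epsilon>\<close> is made arbitrarily small at the end.\<close>

lemma has_delta_derivative_zero_const:
  assumes "closed T" "c \<in> T" "c \<le> d"
    and D: "\<And>t. t \<in> ts_interval T c d \<Longrightarrow> has_delta_derivative T G 0 t"
    and t: "t \<in> ts_interval T c d"
  shows "G t = G c"
proof -
  have jump: "G (forward_jump T t) = G t" if "t \<in> ts_interval T c d" for t
    using has_delta_derivative_jump[OF D[OF that]] by simp
  have bound: "\<bar>G t - G c\<bar> \<le> \<epsilon> * (t - c)" if "\<epsilon> > 0" for \<epsilon>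
  proof (rule time_scale_induct[OF assms(1-3) _ _ _ _ t])
    show "\<bar>G c - G c\<bar> \<le> \<epsilon> * (c - c)" by simp
  next
    fix t assume a: "t \<in> T" "c \<le> t" "t < forward_jump T t" "forward_jump T t \<le> d"
      "\<bar>G t - G c\<bar> \<le> \<epsilon> * (t - c)"
    then have "G (forward_jump T t) = G t" by (intro jump) (auto simp: ts_interval_def)
    moreover have "\<epsilon> * (t - c) \<le> \<epsilon> * (forward_jump T t - c)"
      using a that by (intro mult_left_mono) auto
    ultimately show "\<bar>G (forward_jump T t) - G c\<bar> \<le> \<epsilon> * (forward_jump T t - c)"
      using a by simp
  next
    fix t assume a: "t \<in> T" "c \<le> t" "t < d" "forward_jump T t = t" "\<bar>G t - G c\<bar> \<le> \<epsilon> * (t - c)"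
    then have "t \<in> ts_interval T c d" by (simp add: ts_interval_def)
    from has_delta_derivativeD[OF D[OF this] that] obtain \<delta> where \<delta>: "\<delta> > 0"
      "\<And>s. s \<in> T \<Longrightarrow> \<bar>s - t\<bar> < \<delta> \<Longrightarrow> \<bar>G t - G s\<bar> \<le> \<epsilon> * \<bar>t - s\<bar>"
      unfolding a(4) by auto
    show "\<exists>\<delta>>0. \<forall>s\<in>T. t < s \<and> s < t + \<delta> \<and> s \<le> d \<longrightarrow> \<bar>G s - G c\<bar> \<le> \<epsilon> * (s - c)"
    proof (intro exI[of _ \<delta>] conjI ballI impI)
      fix s assume s: "s \<in> T" "t < s \<and> s < t + \<delta> \<and> s \<le> d"
      have "\<bar>G t - G s\<bar> \<le> \<epsilon> * (s - t)" using \<delta>(2)[of s] s by auto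
      then show "\<bar>G s - G c\<bar> \<le> \<epsilon> * (s - c)" using a(5) by (simp add: algebra_simps)
    qed (fact \<delta>)
  next
    fix t assume a: "t \<in> T" "c < t" "t \<le> d" "backward_jump T t = t"
      and IH: "\<And>s. s \<in> T \<Longrightarrow> c \<le> s \<Longrightarrow> s < t \<Longrightarrow> \<bar>G s - G c\<bar> \<le> \<epsilon> * (s - c)"
    have cont: "continuous (at t within T) G"
      using a by (intro has_delta_derivative_continuous[OF D]) (auto simp: ts_interval_def)
    show "\<bar>G t - G c\<bar> \<le> \<epsilon> * (t - c)"
    proof (rule field_le_epsilon)
      fix e :: real assume "e > 0"
      then obtain \<delta> where \<delta>: "\<delta> > 0" "\<And>s. s \<in> T \<Longrightarrow> \<bar>s - t\<bar> < \<delta> \<Longrightarrow> \<bar>G s - G t\<bar> < e"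
        using cont unfolding continuous_within_eps_delta dist_real_def by metis
      \<comment> \<open>The minimum with \<open>t - c\<close> keeps \<open>s\<close> above
        \<open>c\<close>, where the induction hypothesis is available.\<close>
      obtain s where s: "s \<in> T" "s < t" "t - min \<delta> (t - c) < s"
        using left_dense_approx[OF a(4) assms(2) a(2), of "min \<delta> (t - c)"] \<delta> a(2) by auto
      have "\<bar>G s - G t\<bar> < e" using s by (intro \<delta>) auto
      moreover have "\<bar>G s - G c\<bar> \<le> \<epsilon> * (s - c)" using s by (intro IH) auto
      moreover have "\<epsilon> * (s - c) \<le> \<epsilon> * (t - c)" using s that by (intro mult_left_mono) auto
      ultimately show "\<bar>G t - G c\<bar> \<le> \<epsilon> * (t - c) + e" by linarith
    qed
  qed
  then have "\<bar>G t - G c\<bar> \<le> 0"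
    using t by (intro nonpos_if_le_small_multiple[of _ "t - c"]) (auto simp: ts_interval_def)
  then show ?thesis by simp
qed

section \<open>Multivariate estimates\<close>

lemma real_mvt_abs:
  fixes f :: "real \<Rightarrow> real"
  assumes "\<And>s. (f has_real_derivative f' s) (at s)"
  obtains \<xi> where "\<bar>\<xi> - u\<bar> \<le> \<bar>h\<bar>" "f (u + h) - f u = f' \<xi> * h"
proof (cases h "0::real" rule: linorder_cases)
  case less
  obtain \<xi> where "u + h < \<xi>" "\<xi> < u" "f u - f (u + h) = (u - (u + h)) * f' \<xi>"
    using MVT2[of "u + h" u f f'] assms less by auto
  then show ?thesis using less by (intro that[of \<xi>]) (auto simp: algebra_simps)
next
  case equal
  then show ?thesis by (intro that[of u]) auto
next
  case greater
  obtain \<xi> where "u < \<xi>" "\<xi> < u + h" "f (u + h) - f u = (u + h - u) * f' \<xi>"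
    using MVT2[of u "u + h" f f'] assms greater by auto
  then show ?thesis using greater by (intro that[of \<xi>]) (auto simp: algebra_simps)
qed

text \<open>The coordinates are changed one after another, each by the mean value theorem. The base
  point \<open>w\<close> ranges over a neighbourhood of \<open>z\<close> because the induction
  hypothesis is applied at the point reached after the first change.\<close>

lemma partials_estimate:
  fixes H :: "real ^ 'n::finite \<Rightarrow> real"
  assumes "has_continuous_partials H H'" "e > 0"
  shows "\<exists>d>0. \<forall>w h. norm (w - z) < d \<and> norm h < d \<longrightarrow>
    \<bar>H (w + (\<Sum>i\<in>I. h $ i *\<^sub>R axis i 1)) - H w - (\<Sum>i\<in>I. H' i z * h $ i)\<bar> \<le> e * (\<Sum>i\<in>I. \<bar>h $ i\<bar>)"
proof -
  have "finite I" by simp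
  then show ?thesis
  proof (induction I rule: finite_induct)
    case empty
    then show ?case by (auto intro: exI[of _ 1])
  next
    case (insert i I)
    obtain d where d: "d > 0" "\<And>w h. norm (w - z) < d \<Longrightarrow> norm h < d \<Longrightarrow>
      \<bar>H (w + (\<Sum>i\<in>I. h $ i *\<^sub>R axis i 1)) - H w - (\<Sum>i\<in>I. H' i z * h $ i)\<bar> \<le> e * (\<Sum>i\<in>I. \<bar>h $ i\<bar>)"
      using insert.IH by blast
    obtain d' where d': "d' > 0" "\<And>w. norm (w - z) < d' \<Longrightarrow> \<bar>H' i w - H' i z\<bar> < e"
      using assms unfolding has_continuous_partials_def continuous_on_eq_continuous_at[OF open_UNIV]
        continuous_at_eps_delta dist_norm real_norm_def by (metis UNIV_I)
    \<comment> \<open>Half the radius: \<open>w - z\<close> and the change of one coordinate are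
      each shorter than \<open>r\<close>, so the shifted base point is within both radii.\<close>
    define r where "r = min d d' / 2"
    have "r > 0" using d d' by (simp add: r_def)
    moreover have "\<bar>H (w + (\<Sum>j\<in>insert i I. h $ j *\<^sub>R axis j 1)) - H w - (\<Sum>j\<in>insert i I. H' j z * h $ j)\<bar>
        \<le> e * (\<Sum>j\<in>insert i I. \<bar>h $ j\<bar>)" if wh: "norm (w - z) < r" "norm h < r" for w h
    proof -
      let ?a = "axis i (1::real) :: real ^ 'n"
      let ?w = "w + h $ i *\<^sub>R ?a"
      have hi: "\<bar>h $ i\<bar> < r" using wh component_le_norm_cart[of h i] by linarith
      have shift: "norm (w + s *\<^sub>R ?a - z) < min d d'" if "\<bar>s\<bar> \<le> \<bar>h $ i\<bar>" for s
      proof -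
        have "norm (w + s *\<^sub>R ?a - z) = norm ((w - z) + s *\<^sub>R ?a)" by (simp add: algebra_simps)
        also have "\<dots> \<le> norm (w - z) + \<bar>s\<bar>"
          using norm_triangle_ineq[of "w - z" "s *\<^sub>R ?a"] by simp
        also have "\<dots> < r + r" using wh that hi by linarith
        finally show ?thesis by (simp add: r_def)
      qed
      have "((\<lambda>s. H (w + s *\<^sub>R ?a)) has_real_derivative H' i (w + s *\<^sub>R ?a)) (at s)" for s
      proof -
        have "((\<lambda>u. H ((w + s *\<^sub>R ?a) + u *\<^sub>R ?a)) has_real_derivative H' i (w + s *\<^sub>R ?a)) (at 0)"
          using assms(1) by (simp add: has_continuous_partials_def)
        then have "((\<lambda>u. H (w + (u + s) *\<^sub>R ?a)) has_real_derivative H' i (w + s *\<^sub>R ?a)) (at 0)"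
          by (simp add: algebra_simps)
        then show ?thesis using DERIV_shift[of "\<lambda>s. H (w + s *\<^sub>R ?a)" _ 0 s] by (simp add: add.commute)
      qed
      then obtain \<xi> where \<xi>: "\<bar>\<xi> - 0\<bar> \<le> \<bar>h $ i\<bar>"
          "H (w + (0 + h $ i) *\<^sub>R ?a) - H (w + 0 *\<^sub>R ?a) = H' i (w + \<xi> *\<^sub>R ?a) * h $ i"
        using real_mvt_abs[of "\<lambda>s. H (w + s *\<^sub>R ?a)" "\<lambda>s. H' i (w + s *\<^sub>R ?a)" 0 "h $ i"] by blast
      have "\<bar>H' i (w + \<xi> *\<^sub>R ?a) - H' i z\<bar> < e" using \<xi>(1) shift[of \<xi>] by (intro d') auto
      then have "\<bar>(H' i (w + \<xi> *\<^sub>R ?a) - H' i z) * h $ i\<bar> \<le> e * \<bar>h $ i\<bar>"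
        unfolding abs_mult by (intro mult_right_mono) auto
      then have 1: "\<bar>H ?w - H w - H' i z * h $ i\<bar> \<le> e * \<bar>h $ i\<bar>"
        using \<xi>(2) by (simp add: algebra_simps)
      have 2: "\<bar>H (?w + (\<Sum>i\<in>I. h $ i *\<^sub>R axis i 1)) - H ?w - (\<Sum>i\<in>I. H' i z * h $ i)\<bar> \<le> e * (\<Sum>i\<in>I. \<bar>h $ i\<bar>)"
        using shift[of "h $ i"] wh(2) \<open>r > 0\<close> by (intro d) (auto simp: r_def)
      show ?thesis
        using 1 2 insert.hyps by (simp add: algebra_simps)
    qed
    ultimately show ?case by blast
  qed
qed

lemma continuous_partials_has_derivative:
  fixes H :: "real ^ 'n::finite \<Rightarrow> real"
  assumes "has_continuous_partials H H'"
  shows "(H has_derivative (\<lambda>h. \<Sum>i\<in>UNIV. H' i z * h $ i)) (at z)"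
  unfolding has_derivative_at_alt
proof (intro conjI allI impI)
  show "bounded_linear (\<lambda>h. \<Sum>i\<in>UNIV. H' i z * h $ i)"
    by (intro bounded_linear_sum bounded_linear_const_mult bounded_linear_vec_nth)
  fix e :: real assume "e > 0"
  \<comment> \<open>Each coordinate of \<open>y - z\<close> is bounded by the norm, so the sum of
    their absolute values costs a factor \<open>CARD('n)\<close>.\<close>
  define \<epsilon> where "\<epsilon> = e / CARD('n)"
  have "\<epsilon> > 0" using \<open>e > 0\<close> by (simp add: \<epsilon>_def)
  from partials_estimate[OF assms this, of z UNIV] obtain d where d: "d > 0"
    "\<And>w h. norm (w - z) < d \<Longrightarrow> norm h < d \<Longrightarrow>
      \<bar>H (w + (\<Sum>i\<in>UNIV. h $ i *\<^sub>R axis i 1)) - H w - (\<Sum>i\<in>UNIV. H' i z * h $ i)\<bar>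
        \<le> \<epsilon> * (\<Sum>i\<in>UNIV. \<bar>h $ i\<bar>)" by blast
  have "norm (H y - H z - (\<Sum>i\<in>UNIV. H' i z * (y - z) $ i)) \<le> e * norm (y - z)"
    if "norm (y - z) < d" for y
  proof -
    have "(\<Sum>i\<in>UNIV. (y - z) $ i *\<^sub>R axis i 1) = y - z"
      using basis_expansion[of "y - z"] by (simp add: scalar_mult_eq_scaleR)
    then have "norm (H y - H z - (\<Sum>i\<in>UNIV. H' i z * (y - z) $ i)) \<le> \<epsilon> * (\<Sum>i\<in>UNIV. \<bar>(y - z) $ i\<bar>)"
      using d(2)[of z "y - z"] d(1) that by simp
    also have "\<dots> \<le> \<epsilon> * (\<Sum>i\<in>(UNIV::'n set). norm (y - z))"
      using \<open>\<epsilon> > 0\<close> component_le_norm_cart[of "y - z"]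
      by (intro mult_left_mono sum_mono) (auto simp del: vector_minus_component)
    also have "\<dots> = e * norm (y - z)" by (simp add: \<epsilon>_def)
    finally show ?thesis .
  qed
  then show "\<exists>d>0. \<forall>y. norm (y - z) < d \<longrightarrow>
      norm (H y - H z - (\<Sum>i\<in>UNIV. H' i z * (y - z) $ i)) \<le> e * norm (y - z)"
    using d(1) by blast
qed

text \<open>Only continuity of the constraint near the origin is needed, not continuous
  differentiability: along the direction \<open>(1,c)\<close> tangent to the constraint the second coordinate is
  corrected by means of the intermediate value theorem.\<close>

lemma planar_lagrange:
  fixes \<phi> \<psi> :: "real \<times> real \<Rightarrow> real"
  assumes \<phi>: "(\<phi> has_derivative (\<lambda>p. fst p * \<phi>1 + snd p * \<phi>2)) (at 0)"
    and \<psi>: "(\<psi> has_derivative (\<lambda>p. fst p * \<psi>1 + snd p * \<psi>2)) (at 0)"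
    and cont: "\<And>p. isCont \<psi> p" and "\<psi>2 \<noteq> 0" and "\<delta> > 0"
    and min: "\<And>p. norm p < \<delta> \<Longrightarrow> \<psi> p = \<psi> 0 \<Longrightarrow> \<phi> 0 \<le> \<phi> p"
  shows "\<phi>1 = \<phi>2 / \<psi>2 * \<psi>1"
proof (rule ccontr)
  assume neq: "\<phi>1 \<noteq> \<phi>2 / \<psi>2 * \<psi>1"
  define c where "c = - (\<psi>1 / \<psi>2)"
  define D where "D = \<phi>1 + c * \<phi>2"
  \<comment> \<open>\<open>D\<close> is the slope of \<open>\<phi>\<close> along
    \<open>(1, c)\<close>, and \<open>g\<close> orients that direction so that \<open>\<phi>\<close>
    decreases at rate \<open>\<bar>D\<bar>\<close>.\<close>
  define g where "g = - sgn D"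
  have "D \<noteq> 0" using neq by (auto simp: D_def c_def)
  then have g: "\<bar>g\<bar> = 1" "g * D = - \<bar>D\<bar>" by (auto simp: g_def abs_sgn_eq sgn_real_def abs_if)
  \<comment> \<open>\<open>\<rho>\<close> bounds the correction of the second coordinate, per unit
    of the step size \<open>s\<close>, so that it costs at most a quarter of the gain
    \<open>\<bar>D\<bar>\<close>. Below, \<open>\<epsilon>\<close> keeps the linearization error of
    \<open>\<phi>\<close> within another quarter, and that of \<open>\<psi>\<close> within half of
    what the full correction \<open>\<rho>\<close> achieves.\<close>
  define \<rho> where "\<rho> = \<bar>D\<bar> / (4 * (\<bar>\<phi>2\<bar> + 1))"
  have \<rho>: "\<rho> > 0" "\<rho> * \<bar>\<phi>2\<bar> \<le> \<bar>D\<bar> / 4"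
    using \<open>D \<noteq> 0\<close> by (auto simp: \<rho>_def field_simps)
  define C where "C = 1 + \<bar>c\<bar> + \<rho>"
  have "C > 0" using \<rho> by (simp add: C_def)
  define \<epsilon> where "\<epsilon> = min (\<bar>D\<bar> / 4) (\<rho> * \<bar>\<psi>2\<bar> / 2) / C"
  have \<epsilon>: "\<epsilon> > 0" "\<epsilon> * C \<le> \<bar>D\<bar> / 4" "\<epsilon> * C \<le> \<rho> * \<bar>\<psi>2\<bar> / 2"
    using \<open>D \<noteq> 0\<close> \<open>C > 0\<close> \<rho>(1) \<open>\<psi>2 \<noteq> 0\<close> by (auto simp: \<epsilon>_def)
  obtain d1 where d1: "d1 > 0" "\<And>p. norm p < d1 \<Longrightarrow>
      \<bar>\<phi> p - \<phi> 0 - (fst p * \<phi>1 + snd p * \<phi>2)\<bar> \<le> \<epsilon> * norm p"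
    using \<phi> \<epsilon>(1) unfolding has_derivative_at_alt by auto
  obtain d2 where d2: "d2 > 0" "\<And>p. norm p < d2 \<Longrightarrow>
      \<bar>\<psi> p - \<psi> 0 - (fst p * \<psi>1 + snd p * \<psi>2)\<bar> \<le> \<epsilon> * norm p"
    using \<psi> \<epsilon>(1) unfolding has_derivative_at_alt by auto
  define s where "s = min (min d1 d2) \<delta> / (2 * C)"
  have s: "s > 0" using d1 d2 \<open>\<delta> > 0\<close> \<open>C > 0\<close> by (simp add: s_def)
  have sC: "s * C < d1" "s * C < d2" "s * C < \<delta>"
    using d1(1) d2(1) \<open>\<delta> > 0\<close> \<open>C > 0\<close> by (auto simp: s_def)
  define p where "p r = (s * g, s * (g * c + r))" for r
  have np: "norm (p r) \<le> s * C" if "\<bar>r\<bar> \<le> \<rho>" for r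
  proof -
    have "norm (p r) \<le> \<bar>s * g\<bar> + \<bar>s * (g * c + r)\<bar>"
      unfolding p_def by (metis norm_Pair_le real_norm_def)
    also have "\<dots> = s * (\<bar>g\<bar> + \<bar>g * c + r\<bar>)" unfolding abs_mult using s by (simp add: distrib_left)
    also have "\<dots> \<le> s * C"
    proof (rule mult_left_mono)
      have "\<bar>g * c + r\<bar> \<le> \<bar>g\<bar> * \<bar>c\<bar> + \<bar>r\<bar>" by (metis abs_mult abs_triangle_ineq)
      then show "\<bar>g\<bar> + \<bar>g * c + r\<bar> \<le> C" using g that by (simp add: C_def)
    qed (use s in simp)
    finally show ?thesis .
  qed
  have err: "\<epsilon> * norm (p r) \<le> s * (\<epsilon> * C)" if "\<bar>r\<bar> \<le> \<rho>" for r
    using mult_left_mono[OF np[OF that], of \<epsilon>] \<epsilon>(1) by (simp add: algebra_simps)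
  have \<psi>p: "\<bar>\<psi> (p r) - \<psi> 0 - s * r * \<psi>2\<bar> \<le> s * (\<rho> * \<bar>\<psi>2\<bar> / 2)" if "\<bar>r\<bar> \<le> \<rho>" for r
  proof -
    have "fst (p r) * \<psi>1 + snd (p r) * \<psi>2 = s * r * \<psi>2"
      using \<open>\<psi>2 \<noteq> 0\<close> by (simp add: p_def c_def field_simps)
    then have "\<bar>\<psi> (p r) - \<psi> 0 - s * r * \<psi>2\<bar> \<le> \<epsilon> * norm (p r)"
      using d2(2)[of "p r"] np[OF that] sC by simp
    also have "\<dots> \<le> s * (\<epsilon> * C)" by (rule err[OF that])
    also have "\<dots> \<le> s * (\<rho> * \<bar>\<psi>2\<bar> / 2)" using s \<epsilon> by (intro mult_left_mono) auto
    finally show ?thesis .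
  qed
  have pos: "s * \<rho> * \<bar>\<psi>2\<bar> > 0" using s \<rho> \<open>\<psi>2 \<noteq> 0\<close> by simp
  have contp: "isCont (\<lambda>r. \<psi> (p r)) r" for r
    unfolding p_def by (intro isCont_o2[OF _ cont] continuous_intros)
  have ends: "\<bar>\<psi> (p \<rho>) - \<psi> 0 - s * \<rho> * \<psi>2\<bar> \<le> s * \<rho> * \<bar>\<psi>2\<bar> / 2"
      "\<bar>\<psi> (p (- \<rho>)) - \<psi> 0 + s * \<rho> * \<psi>2\<bar> \<le> s * \<rho> * \<bar>\<psi>2\<bar> / 2"
    using \<psi>p[of \<rho>] \<psi>p[of "- \<rho>"] \<rho>(1) by (auto simp: mult.assoc)
  \<comment> \<open>The full corrections \<open>\<rho>\<close> and \<open>- \<rho>\<close> move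
    \<open>\<psi>\<close> to opposite sides of \<open>\<psi> 0\<close>; the sign of
    \<open>\<psi>2\<close> decides which of them lies above.\<close>
  have "\<exists>r. - \<rho> \<le> r \<and> r \<le> \<rho> \<and> \<psi> (p r) = \<psi> 0"
  proof (cases "\<psi>2 > 0")
    case True
    have "\<psi> (p (- \<rho>)) \<le> \<psi> 0" "\<psi> 0 \<le> \<psi> (p \<rho>)"
      using ends pos unfolding abs_of_pos[OF True] by linarith+
    then show ?thesis using IVT[of "\<lambda>r. \<psi> (p r)" "- \<rho>" "\<psi> 0" \<rho>] contp \<rho>(1) by auto
  next
    case False
    then have "s * \<rho> * \<bar>\<psi>2\<bar> = - (s * \<rho> * \<psi>2)" by simp
    then have "\<psi> (p \<rho>) \<le> \<psi> 0" "\<psi> 0 \<le> \<psi> (p (- \<rho>))"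
      using ends pos by linarith+
    then show ?thesis using IVT2[of "\<lambda>r. \<psi> (p r)" \<rho> "\<psi> 0" "- \<rho>"] contp \<rho>(1) by auto
  qed
  then obtain r where r: "\<bar>r\<bar> \<le> \<rho>" "\<psi> (p r) = \<psi> 0" by (metis abs_le_iff minus_le_iff)
  have "\<phi> 0 \<le> \<phi> (p r)" using np[OF r(1)] sC r by (intro min) auto
  moreover have "fst (p r) * \<phi>1 + snd (p r) * \<phi>2 = s * (g * D + r * \<phi>2)"
    by (simp add: p_def D_def algebra_simps)
  then have "\<phi> (p r) - \<phi> 0 \<le> s * (g * D + r * \<phi>2) + \<epsilon> * norm (p r)"
    using d1(2)[of "p r"] np[OF r(1)] sC by (simp add: abs_le_iff)
  moreover have "\<epsilon> * norm (p r) \<le> s * (\<bar>D\<bar> / 4)"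
    using err[OF r(1)] mult_left_mono[OF \<epsilon>(2), of s] s by linarith
  moreover have "s * (g * D + r * \<phi>2) \<le> s * (- \<bar>D\<bar> + \<bar>D\<bar> / 4)"
  proof (rule mult_left_mono)
    have "r * \<phi>2 \<le> \<bar>r\<bar> * \<bar>\<phi>2\<bar>" by (metis abs_ge_self abs_mult)
    also have "\<dots> \<le> \<rho> * \<bar>\<phi>2\<bar>" using r by (intro mult_right_mono) auto
    finally show "g * D + r * \<phi>2 \<le> - \<bar>D\<bar> + \<bar>D\<bar> / 4" using g \<rho> by linarith
  qed (use s in simp)
  moreover have "s * (- \<bar>D\<bar> + \<bar>D\<bar> / 4) + s * (\<bar>D\<bar> / 4) < 0"
    using s \<open>D \<noteq> 0\<close> by (simp add: algebra_simps)
  ultimately show False by linarith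
qed

text \<open>A Lebesgue number of the cover of \<open>C\<close> by the local balls puts
  \<open>p\<close> and \<open>q\<close> into one ball, at whose centre the value differs from both
  by less than \<open>e / 2\<close>. The point \<open>q\<close> may leave \<open>C\<close>, as
  perturbed arguments do.\<close>

lemma uniformly_continuous_in_time:
  assumes "continuous_uniformly_in_time S \<phi>" "e > 0" "compact C"
  obtains d where "d > 0" "\<And>t p q. t \<in> S \<Longrightarrow> p \<in> C \<Longrightarrow> dist q p < d \<Longrightarrow>
    \<bar>\<phi> t (fst q) (snd q) - \<phi> t (fst p) (snd p)\<bar> < e"
proof -
  have "\<exists>d>0. \<forall>t\<in>S. \<forall>q. dist q p < d \<longrightarrow> \<bar>\<phi> t (fst q) (snd q) - \<phi> t (fst p) (snd p)\<bar> < e / 2"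
    for p :: "real \<times> real"
    using assms(1,2) unfolding continuous_uniformly_in_time_def
    by (metis half_gt_zero prod.collapse)
  then obtain d where d: "\<And>p. d p > 0" "\<And>p t q. t \<in> S \<Longrightarrow> dist q p < d p \<Longrightarrow>
      \<bar>\<phi> t (fst q) (snd q) - \<phi> t (fst p) (snd p)\<bar> < e / 2"
    by metis
  have "C \<subseteq> \<Union>((\<lambda>p. ball p (d p)) ` C)" using d(1) by force
  then obtain r where r: "r > 0" "\<And>p. p \<in> C \<Longrightarrow> \<exists>U\<in>(\<lambda>p. ball p (d p)) ` C. ball p r \<subseteq> U"
    using Heine_Borel_lemma[OF assms(3), of "(\<lambda>p. ball p (d p)) ` C"] by blast
  show thesis
  proof (rule that[OF r(1)])
    fix t p q assume a: "t \<in> S" "p \<in> C" "dist q p < r"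
    obtain c where c: "ball p r \<subseteq> ball c (d c)" using r(2)[OF a(2)] by blast
    have "p \<in> ball p r" "q \<in> ball p r" using r(1) a(3) by (auto simp: dist_commute)
    then have "p \<in> ball c (d c)" "q \<in> ball c (d c)" using c by blast+
    then have "dist p c < d c" "dist q c < d c" by (auto simp: dist_commute)
    from d(2)[OF a(1) this(1)] d(2)[OF a(1) this(2)]
    show "\<bar>\<phi> t (fst q) (snd q) - \<phi> t (fst p) (snd p)\<bar> < e" by linarith
  qed
qed

text \<open>Moving \<open>y\<close> first and \<open>v\<close> second reduces the claim to two mean
  value theorems. That one \<open>d\<close> serves all \<open>t\<close> is what allows the expansion
  to be integrated over \<open>[a,b]\<close>.\<close>

lemma regular_integrand_estimate:
  assumes f: "regular_integrand T a b f fy fv" and "e > 0"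
  obtains d where "d > 0" "\<And>t y v h w. t \<in> ts_interval T a b \<Longrightarrow> \<bar>y\<bar> \<le> R \<Longrightarrow> \<bar>v\<bar> \<le> R \<Longrightarrow>
    \<bar>h\<bar> < d \<Longrightarrow> \<bar>w\<bar> < d \<Longrightarrow>
    \<bar>f t (y + h) (v + w) - f t y v - (fy t y v * h + fv t y v * w)\<bar> \<le> e * (\<bar>h\<bar> + \<bar>w\<bar>)"
proof -
  let ?C = "cbox (- R, - R) (R, R) :: (real \<times> real) set"
  have C: "compact ?C" by simp
  obtain d1 where d1: "d1 > 0" "\<And>t p q. t \<in> ts_interval T a b \<Longrightarrow> p \<in> ?C \<Longrightarrow> dist q p < d1 \<Longrightarrow>
      \<bar>fy t (fst q) (snd q) - fy t (fst p) (snd p)\<bar> < e"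
    using uniformly_continuous_in_time[OF _ \<open>e > 0\<close> C] f unfolding regular_integrand_def by metis
  obtain d2 where d2: "d2 > 0" "\<And>t p q. t \<in> ts_interval T a b \<Longrightarrow> p \<in> ?C \<Longrightarrow> dist q p < d2 \<Longrightarrow>
      \<bar>fv t (fst q) (snd q) - fv t (fst p) (snd p)\<bar> < e"
    using uniformly_continuous_in_time[OF _ \<open>e > 0\<close> C] f unfolding regular_integrand_def by metis
  define d where "d = min d1 d2 / 2"
  show thesis
  proof (rule that)
    show "d > 0" using d1 d2 by (simp add: d_def)
    fix t y v h w assume t: "t \<in> ts_interval T a b" and yv: "\<bar>y\<bar> \<le> R" "\<bar>v\<bar> \<le> R"
      and hw: "\<bar>h\<bar> < d" "\<bar>w\<bar> < d"
    then have "d > 0" by linarith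
    have p: "(y, v) \<in> ?C" using yv by (auto simp: cbox_Pair_eq abs_le_iff)
    have near: "dist (y', v') (y, v) < d1" "dist (y', v') (y, v) < d2"
      if "\<bar>y' - y\<bar> < d" "\<bar>v' - v\<bar> < d" for y' v'
    proof -
      have "dist (y', v') (y, v) \<le> \<bar>y' - y\<bar> + \<bar>v' - v\<bar>"
        unfolding dist_Pair_Pair dist_real_def by (simp add: sqrt_sum_squares_le_sum_abs)
      also have "\<dots> < min d1 d2" using that by (simp add: d_def)
      finally show "dist (y', v') (y, v) < d1" "dist (y', v') (y, v) < d2" by auto
    qed
    obtain \<xi> where \<xi>: "\<bar>\<xi> - y\<bar> \<le> \<bar>h\<bar>" "f t (y + h) (v + w) - f t y (v + w) = fy t \<xi> (v + w) * h"
      using real_mvt_abs[of "\<lambda>y. f t y (v + w)" "\<lambda>y. fy t y (v + w)" y h] f t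
      unfolding regular_integrand_def by metis
    obtain \<zeta> where \<zeta>: "\<bar>\<zeta> - v\<bar> \<le> \<bar>w\<bar>" "f t y (v + w) - f t y v = fv t y \<zeta> * w"
      using real_mvt_abs[of "\<lambda>v. f t y v" "\<lambda>v. fv t y v" v w] f t
      unfolding regular_integrand_def by metis
    have 1: "\<bar>fy t \<xi> (v + w) - fy t y v\<bar> \<le> e"
      using d1(2)[OF t p near(1)[of \<xi> "v + w"]] \<xi>(1) hw by simp
    have 2: "\<bar>fv t y \<zeta> - fv t y v\<bar> \<le> e"
      using d2(2)[OF t p near(2)[of y \<zeta>]] \<zeta>(1) hw \<open>d > 0\<close> by simp
    have "f t (y + h) (v + w) - f t y v - (fy t y v * h + fv t y v * w)
        = (fy t \<xi> (v + w) - fy t y v) * h + (fv t y \<zeta> - fv t y v) * w"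
      using \<xi>(2) \<zeta>(2) by (simp add: algebra_simps)
    also have "\<bar>\<dots>\<bar> \<le> \<bar>fy t \<xi> (v + w) - fy t y v\<bar> * \<bar>h\<bar> + \<bar>fv t y \<zeta> - fv t y v\<bar> * \<bar>w\<bar>"
      by (metis abs_mult abs_triangle_ineq)
    also have "\<dots> \<le> e * \<bar>h\<bar> + e * \<bar>w\<bar>" by (intro add_mono mult_right_mono 1 2) auto
    finally show "\<bar>f t (y + h) (v + w) - f t y v - (fy t y v * h + fv t y v * w)\<bar> \<le> e * (\<bar>h\<bar> + \<bar>w\<bar>)"
      by (simp add: algebra_simps)
  qed
qed

lemma has_derivative_vec_lambda:
  fixes \<phi> :: "'n::finite \<Rightarrow> 'a::real_normed_vector \<Rightarrow> real"
  assumes "\<And>i. (\<phi> i has_derivative \<phi>' i) F"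
  shows "((\<lambda>p. \<chi> i. \<phi> i p) has_derivative (\<lambda>p. \<chi> i. \<phi>' i p)) F"
proof -
  have *: "(\<chi> i. v i) = (\<Sum>i\<in>UNIV. v i *\<^sub>R axis i 1)" for v :: "'n \<Rightarrow> real"
    using basis_expansion[of "\<chi> i. v i"] by (simp add: scalar_mult_eq_scaleR)
  show ?thesis
    unfolding * by (intro has_derivative_sum has_derivative_scaleR_left assms)
qed

section \<open>Rd-continuous functions and delta integrals\<close>

lemma rd_continuous_on_subset:
  assumes "rd_continuous_on T S \<phi>" "S' \<subseteq> S"
  shows "rd_continuous_on T S' \<phi>"
  unfolding rd_continuous_on_def
proof (intro ballI conjI impI)
  fix t assume t: "t \<in> S'"
  show "continuous (at t within S') \<phi>" if "forward_jump T t = t"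
    using assms t that continuous_within_subset unfolding rd_continuous_on_def by blast
  assume "backward_jump T t = t"
  then obtain l where "(\<phi> \<longlongrightarrow> l) (at t within S \<inter> {..<t})"
    using assms t unfolding rd_continuous_on_def by blast
  then have "(\<phi> \<longlongrightarrow> l) (at t within S' \<inter> {..<t})"
    by (rule tendsto_within_subset) (use assms in auto)
  then show "\<exists>l. (\<phi> \<longlongrightarrow> l) (at t within S' \<inter> {..<t})" ..
qed

lemma rd_continuous_on_cong:
  assumes "rd_continuous_on T S \<phi>" "\<And>t. t \<in> S \<Longrightarrow> \<phi> t = \<psi> t"
  shows "rd_continuous_on T S \<psi>"
  unfolding rd_continuous_on_def
proof (intro ballI conjI impI)
  fix t assume t: "t \<in> S"
  show "continuous (at t within S) \<psi>" if "forward_jump T t = t"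
  proof -
    have "continuous (at t within S) \<phi>" using assms t that by (auto simp: rd_continuous_on_def)
    then show ?thesis
      using assms(2) t unfolding continuous_within
      by (auto elim!: Lim_transform_within[where d = 1])
  qed
  assume "backward_jump T t = t"
  then obtain l where "(\<phi> \<longlongrightarrow> l) (at t within S \<inter> {..<t})"
    using assms t unfolding rd_continuous_on_def by blast
  then have "(\<psi> \<longlongrightarrow> l) (at t within S \<inter> {..<t})"
    using assms(2) by (auto elim!: Lim_transform_within[where d = 1])
  then show "\<exists>l. (\<psi> \<longlongrightarrow> l) (at t within S \<inter> {..<t})" ..
qed

lemma rd_continuous_on_const: "rd_continuous_on T S (\<lambda>_. c)"
  unfolding rd_continuous_on_def by (auto intro: tendsto_const)

lemma rd_continuous_on_add:
  assumes "rd_continuous_on T S \<phi>" "rd_continuous_on T S \<psi>"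
  shows "rd_continuous_on T S (\<lambda>t. \<phi> t + \<psi> t)"
  using assms unfolding rd_continuous_on_def by (metis continuous_add tendsto_add)

lemma rd_continuous_on_mult:
  assumes "rd_continuous_on T S \<phi>" "rd_continuous_on T S \<psi>"
  shows "rd_continuous_on T S (\<lambda>t. \<phi> t * \<psi> t)"
  using assms unfolding rd_continuous_on_def by (metis continuous_mult tendsto_mult)

lemma rd_continuous_on_lincomb:
  assumes "rd_continuous_on T S \<phi>" "rd_continuous_on T S \<psi>"
  shows "rd_continuous_on T S (\<lambda>t. c * \<phi> t + d * \<psi> t)"
  by (intro rd_continuous_on_add rd_continuous_on_mult rd_continuous_on_const assms)

lemma rd_continuous_on_sum:
  assumes "\<And>i. i \<in> I \<Longrightarrow> rd_continuous_on T S (\<phi> i)"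
  shows "rd_continuous_on T S (\<lambda>t. \<Sum>i\<in>I. \<phi> i t)"
  using assms
  by (induction I rule: infinite_finite_induct)
    (auto intro: rd_continuous_on_const rd_continuous_on_add)

lemma rd_continuous_on_continuous:
  assumes "\<And>t. t \<in> S \<Longrightarrow> continuous (at t within S) \<phi>"
  shows "rd_continuous_on T S \<phi>"
  unfolding rd_continuous_on_def
proof (intro ballI conjI impI)
  fix t assume "t \<in> S"
  from assms[OF this] have "(\<phi> \<longlongrightarrow> \<phi> t) (at t within S)" by (simp add: continuous_within)
  then have "(\<phi> \<longlongrightarrow> \<phi> t) (at t within S \<inter> {..<t})" by (rule tendsto_within_subset) auto
  then show "\<exists>l. (\<phi> \<longlongrightarrow> l) (at t within S \<inter> {..<t})" ..
qed (rule assms)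

section \<open>Extension to the real line by rounding down to the segment\<close>

locale time_scale_segment =
  fixes T :: "real set" and a b B :: real
  assumes closed_T: "closed T" and a_in: "a \<in> T" and b_in: "b \<in> T" and B_in: "B \<in> T"
    and ab: "a < b" and bB: "b < B"
begin

abbreviation "S \<equiv> ts_interval T a b"
abbreviation "\<sigma> \<equiv> forward_jump T"
abbreviation "rd \<equiv> rd_continuous_on T S"

text \<open>The \<open>max a s\<close> keeps the set nonempty for \<open>s\<close> below
  \<open>a\<close>. So \<open>snap\<close> rounds down to \<open>S\<close> between \<open>a\<close>
  and \<open>b\<close> and is constant on either side.\<close>

definition snap :: "real \<Rightarrow> real" where
  "snap s = Sup {t \<in> S. t \<le> max a s}"

lemma S_iff: "t \<in> S \<longleftrightarrow> t \<in> T \<and> a \<le> t \<and> t \<le> b"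
  by (auto simp: ts_interval_def)

lemma closed_S: "closed S"
proof -
  have "S = T \<inter> {a..b}" by (auto simp: S_iff)
  then show ?thesis using closed_T by auto
qed

lemma aS: "a \<in> S" and bS: "b \<in> S"
  using a_in b_in ab by (auto simp: S_iff)

text \<open>This is what the point \<open>B\<close> beyond \<open>b\<close> provides: even
  \<open>b\<close> is a point where delta derivatives in \<open>T\<close> make sense.\<close>

lemma S_kappa: "t \<in> S \<Longrightarrow> t \<in> kappa T"
  using kappaI[of t T B] B_in bB by (auto simp: S_iff)

lemma snap_in: "snap s \<in> S" and snap_le: "snap s \<le> max a s"
proof -
  have ne: "{t \<in> S. t \<le> max a s} \<noteq> {}" using aS by auto
  have "snap s \<in> closure {t \<in> S. t \<le> max a s}"
    unfolding snap_def by (rule closure_contains_Sup[OF ne]) (auto simp: S_iff intro!: bdd_aboveI[of _ b])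
  also have "\<dots> \<subseteq> S \<inter> {..max a s}" by (rule closure_minimal) (use closed_S in auto)
  finally show "snap s \<in> S" "snap s \<le> max a s" by auto
qed

lemma snap_ge: "t \<in> S \<Longrightarrow> t \<le> max a s \<Longrightarrow> t \<le> snap s"
  unfolding snap_def by (intro cSup_upper bdd_aboveI[of _ b]) (auto simp: S_iff)

lemma snap_mono: "s \<le> u \<Longrightarrow> snap s \<le> snap u"
  using snap_ge[OF snap_in, of s u] snap_le[of s] by auto

lemma snap_S: "t \<in> S \<Longrightarrow> snap t = t"
  using snap_ge[of t t] snap_le[of t] by (auto simp: S_iff)

lemma snap_left: "s \<le> a \<Longrightarrow> snap s = a" and snap_right: "b \<le> s \<Longrightarrow> snap s = b"
  using snap_le[of s] snap_in[of s] snap_ge[OF bS, of s] by (auto simp: S_iff)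

lemma snap_clamp: "s \<in> T \<Longrightarrow> snap s = max a (min s b)"
  using snap_left[of s] snap_right[of s] snap_S[of s] ab
  by (cases "s \<le> a"; cases "b \<le> s") (auto simp: S_iff)

lemma S_gap:
  assumes "x \<notin> S"
  obtains d where "d > 0" "\<And>s. s \<in> S \<Longrightarrow> d \<le> \<bar>s - x\<bar>"
proof -
  have "open (- S)" using closed_S by (simp add: closed_def)
  then obtain d where d: "d > 0" "ball x d \<subseteq> - S"
    using assms unfolding open_contains_ball by blast
  have "d \<le> \<bar>s - x\<bar>" if "s \<in> S" for s
  proof -
    have "s \<notin> ball x d" using d that by blast
    then show ?thesis by (simp add: dist_real_def abs_minus_commute)
  qed
  then show thesis using that d by blast
qed

lemma sigma_S: "t \<in> S \<Longrightarrow> t < b \<Longrightarrow> \<sigma> t \<in> S"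
  using forward_jump_in[OF closed_T, of t] forward_jump_le[OF b_in, of t] forward_jump_ge[of t T]
  by (auto simp: S_iff)

lemma snap_gap:
  assumes "t \<in> T" "t \<le> s" "s < \<sigma> t"
  shows "snap s = snap t"
proof (rule antisym)
  have "snap s \<le> max a t"
    using snap_le[of s] snap_in[of s] forward_jump_le[of "snap s" T t] assms
    by (cases "snap s \<le> t") (auto simp: S_iff)
  then show "snap s \<le> snap t" by (rule snap_ge[OF snap_in])
qed (rule snap_mono, fact)

text \<open>For \<open>u\<close> to the left of a left-scattered \<open>x\<close>,
  \<open>snap u\<close> may be far from \<open>x\<close>. A point \<open>s\<close> of
  \<open>T\<close> near \<open>x\<close> and below \<open>u\<close> prevents this, since
  \<open>snap u\<close> cannot fall below it inside the segment. In \<open>rd_primitive\<close> the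
  integration variable runs between \<open>x\<close> and such an \<open>s\<close>.\<close>

lemma rd_right_dense:
  assumes "rd \<phi>" "x \<in> T" "\<sigma> x = x" "e > 0"
  shows "\<exists>d>0. \<forall>u. \<bar>u - x\<bar> < d \<and> (x \<le> u \<or> (\<exists>s\<in>T. s \<le> u \<and> \<bar>s - x\<bar> < d)) \<longrightarrow>
    \<bar>\<phi> (snap u) - \<phi> (snap x)\<bar> < e"
proof -
  consider "x < a" | "b < x" | "x \<in> S" using assms by (force simp: S_iff)
  then show ?thesis
  proof cases
    case 1
    show ?thesis
      using 1 \<open>e > 0\<close> by (intro exI[of _ "a - x"]) (auto simp: snap_left)
  next
    case 2
    show ?thesis
      using 2 \<open>e > 0\<close> by (intro exI[of _ "x - b"]) (auto simp: snap_right)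
  next
    case 3
    then obtain d where d: "d > 0" "\<And>s. s \<in> S \<Longrightarrow> \<bar>s - x\<bar> < d \<Longrightarrow> \<bar>\<phi> s - \<phi> x\<bar> < e"
      using assms unfolding rd_continuous_on_def continuous_within_eps_delta dist_real_def by metis
    show ?thesis
    proof (intro exI[of _ d] conjI allI impI)
      fix u assume u: "\<bar>u - x\<bar> < d \<and> (x \<le> u \<or> (\<exists>s\<in>T. s \<le> u \<and> \<bar>s - x\<bar> < d))"
      have "\<bar>snap u - x\<bar> < d"
      proof (cases "x \<le> u")
        case True
        then show ?thesis
          using snap_mono[of x u] snap_le[of u] snap_S[OF 3] u 3 by (auto simp: S_iff)
      next
        case False
        then obtain s where s: "s \<in> T" "s \<le> u" "\<bar>s - x\<bar> < d" using u by blast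
        then have "s \<le> snap u"
          using snap_mono[of s u] snap_clamp[of s] 3 False by (auto simp: S_iff)
        then show ?thesis
          using snap_mono[of u x] snap_S[OF 3] s False by auto
      qed
      then show "\<bar>\<phi> (snap u) - \<phi> (snap x)\<bar> < e"
        using d(2)[OF snap_in] by (simp add: snap_S[OF 3])
    qed (fact d)
  qed
qed

lemma rd_tendsto_right:
  assumes "rd \<phi>" "x \<in> T" "\<sigma> x = x"
  shows "continuous (at x within T) (\<phi> \<circ> snap)"
    and "((\<phi> \<circ> snap) \<longlongrightarrow> \<phi> (snap x)) (at_right x)"
proof -
  have near: "\<exists>d>0. \<forall>u. \<bar>u - x\<bar> < d \<and> (x \<le> u \<or> u \<in> T) \<longrightarrow> \<bar>\<phi> (snap u) - \<phi> (snap x)\<bar> < e"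
    if e: "e > 0" for e
    using rd_right_dense[OF assms e] by (elim exE) force
  show "continuous (at x within T) (\<phi> \<circ> snap)"
    unfolding continuous_within_eps_delta dist_real_def comp_def using near by blast
  show "((\<phi> \<circ> snap) \<longlongrightarrow> \<phi> (snap x)) (at_right x)"
    unfolding Lim_within dist_real_def comp_def using near by (meson greaterThan_iff less_imp_le)
qed

lemma snap_right_const:
  assumes "x \<notin> S \<or> \<sigma> x > x"
  shows "\<exists>d>0. \<forall>s. x \<le> s \<and> s < x + d \<longrightarrow> snap s = snap x"
proof (cases "x \<in> S")
  case True
  then have "x \<in> T" "x < \<sigma> x" using assms by (auto simp: S_iff)
  show ?thesis
  proof (intro exI[of _ "\<sigma> x - x"] conjI allI impI)
    show "snap s = snap x" if "x \<le> s \<and> s < x + (\<sigma> x - x)" for s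
      using snap_gap[OF \<open>x \<in> T\<close>, of s] that by simp
  qed (use \<open>x < \<sigma> x\<close> in simp)
next
  case False
  then obtain d where d: "d > 0" "\<And>s. s \<in> S \<Longrightarrow> d \<le> \<bar>s - x\<bar>" using S_gap by blast
  have "snap s = snap x" if s: "x \<le> s" "s < x + d" for s
  proof (cases "s \<le> a")
    case True
    then show ?thesis using s by (simp add: snap_left)
  next
    case False
    show ?thesis
    proof (rule antisym[OF snap_ge[OF snap_in] snap_mono[OF s(1)]])
      show "snap s \<le> max a x" using d(2)[OF snap_in, of s] snap_le[of s] s False by auto
    qed
  qed
  then show ?thesis using d by blast
qed

lemma snap_left_const:
  assumes "x \<notin> S \<or> x \<le> a \<or> backward_jump T x < x"
  shows "\<exists>d>0. \<exists>c\<in>S. \<forall>s. x - d < s \<and> s < x \<longrightarrow> snap s = c"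
proof (cases "x \<le> a")
  case True
  then show ?thesis using aS by (intro exI[of _ 1]) (auto simp: snap_left intro!: bexI[of _ a])
next
  case False
  have "\<exists>d>0. \<forall>s\<in>S. s < x \<longrightarrow> s \<le> x - d"
  proof (cases "x \<in> S")
    case True
    then show ?thesis
      using assms False backward_jump_ge[of _ T x]
      by (intro exI[of _ "x - backward_jump T x"]) (auto simp: S_iff)
  next
    case False
    then obtain d where d: "d > 0" "\<And>s. s \<in> S \<Longrightarrow> d \<le> \<bar>s - x\<bar>" using S_gap by blast
    have "s \<le> x - d" if "s \<in> S" "s < x" for s
      using d(2)[OF that(1)] that(2) by auto
    then show ?thesis using d by blast
  qed
  then obtain d where d: "d > 0" "\<And>s. s \<in> S \<Longrightarrow> s < x \<Longrightarrow> s \<le> x - d" by blast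
  have "a \<le> x - d" using d(2)[OF aS] False by simp
  have "snap s = snap (x - d)" if s: "x - d < s" "s < x" for s
  proof (rule antisym[OF snap_ge[OF snap_in] snap_mono])
    have "snap s < x" using snap_le[of s] s False by auto
    then show "snap s \<le> max a (x - d)" using d(2)[OF snap_in] by fastforce
  qed (use s in auto)
  then show ?thesis using d snap_in by blast
qed

text \<open>On each side of \<open>x\<close>, either density and rd-continuity give the limit, or
  \<open>snap\<close> is constant near \<open>x\<close> on that side.\<close>

lemma rd_regulated:
  assumes "rd \<phi>"
  shows "regulated (\<phi> \<circ> snap)"
  unfolding regulated_def
proof (intro allI conjI)
  fix x
  show "\<exists>r. ((\<phi> \<circ> snap) \<longlongrightarrow> r) (at_right x)"
  proof (cases "x \<in> S \<and> \<sigma> x = x")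
    case True
    then show ?thesis using rd_tendsto_right(2)[OF assms] by (auto simp: S_iff)
  next
    case False
    then have "x \<notin> S \<or> \<sigma> x > x" using forward_jump_ge[of x T] by linarith
    from snap_right_const[OF this] obtain d
      where d: "d > 0" "\<And>s. x \<le> s \<Longrightarrow> s < x + d \<Longrightarrow> snap s = snap x" by blast
    have "\<forall>\<^sub>F s in at_right x. (\<phi> \<circ> snap) s = \<phi> (snap x)"
      unfolding eventually_at_right_field
      by (rule exI[of _ "x + d"]) (use d(1) d(2)[OF less_imp_le] in simp)
    then show ?thesis using tendsto_eventually by blast
  qed
  show "\<exists>l. ((\<phi> \<circ> snap) \<longlongrightarrow> l) (at_left x)"
  proof (cases "x \<in> S \<and> a < x \<and> backward_jump T x = x")
    case False
    then have "x \<notin> S \<or> x \<le> a \<or> backward_jump T x < x" using backward_jump_le[of T x] by linarith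
    from snap_left_const[OF this] obtain d c
      where d: "d > 0" "\<And>s. x - d < s \<Longrightarrow> s < x \<Longrightarrow> snap s = c" by blast
    have "\<forall>\<^sub>F s in at_left x. (\<phi> \<circ> snap) s = \<phi> c"
      unfolding eventually_at_left_field
      by (rule exI[of _ "x - d"]) (use d in simp)
    then show ?thesis using tendsto_eventually by blast
  next
    case True
    then obtain l where l: "(\<phi> \<longlongrightarrow> l) (at x within S \<inter> {..<x})"
      using assms by (auto simp: rd_continuous_on_def)
    have "((\<phi> \<circ> snap) \<longlongrightarrow> l) (at_left x)"
    proof (rule tendstoI)
      fix e :: real assume "e > 0"
      then obtain d where d: "d > 0" "\<And>s. s \<in> S \<Longrightarrow> s < x \<Longrightarrow> dist s x < d \<Longrightarrow> dist (\<phi> s) l < e"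
        using l unfolding Lim_within by auto
      \<comment> \<open>For every real \<open>s\<close> between \<open>u\<close> and
        \<open>x\<close> the point \<open>snap s\<close> is trapped between \<open>u\<close> and
        \<open>x\<close>, hence within the reach of the limit along \<open>S\<close>.\<close>
      obtain u where u: "u \<in> T" "u < x" "x - min d (x - a) < u"
        using left_dense_approx[of T x a "min d (x - a)"] True a_in d(1) by auto
      then have "u \<in> S" using True by (auto simp: S_iff)
      have "dist (\<phi> (snap s)) l < e" if "u < s" "s < x" for s
        using d(2)[OF snap_in, of s] snap_ge[OF \<open>u \<in> S\<close>, of s] snap_le[of s] that u True
        by (auto simp: dist_real_def)
      then show "\<forall>\<^sub>F s in at_left x. dist ((\<phi> \<circ> snap) s) l < e"
        using u by (auto simp: eventually_at_left_field)
    qed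
    then show ?thesis ..
  qed
qed

lemma rd_bounded:
  assumes "rd \<phi>"
  obtains M where "M \<ge> 0" "\<And>t. t \<in> S \<Longrightarrow> \<bar>\<phi> t\<bar> \<le> M"
proof -
  obtain M where M: "\<forall>x\<in>{a..b}. \<bar>(\<phi> \<circ> snap) x\<bar> \<le> M"
    using regulated_bounded[OF rd_regulated[OF assms]] by blast
  then have "\<bar>\<phi> t\<bar> \<le> M" if "t \<in> S" for t
    using bspec[OF M, of t] snap_S[OF that] that by (simp add: S_iff)
  moreover from this[OF aS] have "M \<ge> 0" by linarith
  ultimately show ?thesis using that by blast
qed

text \<open>Outside \<open>[a,b]\<close> the function \<open>\<phi> \<circ> snap\<close> is constant on either side, so \<open>G\<close> is delta
  differentiable on all of \<open>T\<close>, as membership in \<open>C1rd T\<close> requires.\<close>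

lemma rd_primitive:
  assumes "rd \<phi>"
  obtains G where "\<And>u v. u \<le> v \<Longrightarrow> ((\<phi> \<circ> snap) has_integral G v - G u) {u..v}"
    and "\<And>t. t \<in> kappa T \<Longrightarrow> has_delta_derivative T G (\<phi> (snap t)) t"
proof -
  let ?h = "\<phi> \<circ> snap"
  obtain G where G: "\<And>u v. u \<le> v \<Longrightarrow> (?h has_integral G v - G u) {u..v}"
    using regulated_primitive[OF rd_regulated[OF assms]] by blast
  \<comment> \<open>The bound is assumed on a half-open interval because \<open>snap\<close> may
    jump at the right end, in particular at \<open>\<sigma> t\<close>; a single point does not
    affect the integral.\<close>
  have est: "\<bar>G v - G u - c * (v - u)\<bar> \<le> e * \<bar>v - u\<bar>"
    if "\<And>s. min u v \<le> s \<Longrightarrow> s < max u v \<Longrightarrow> \<bar>?h s - c\<bar> \<le> e" "e \<ge> 0" for u v c e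
  proof -
    have *: "\<bar>G v - G u - c * (v - u)\<bar> \<le> e * (v - u)"
      if "u \<le> v" "\<And>s. u \<le> s \<Longrightarrow> s < v \<Longrightarrow> \<bar>?h s - c\<bar> \<le> e" for u v
    proof -
      have 1: "((\<lambda>s. ?h s - c) has_integral G v - G u - (v - u) *\<^sub>R c) (cbox u v)"
        using has_integral_diff[OF G[OF that(1)] has_integral_const_real[of c u v]] that(1) by simp
      have 2: "((\<lambda>s. if s = v then 0 else ?h s - c) has_integral G v - G u - (v - u) *\<^sub>R c) (cbox u v)"
        by (rule has_integral_spike_finite[OF _ _ 1, of "{v}"]) auto
      have "norm (G v - G u - (v - u) *\<^sub>R c) \<le> e * measure lborel (cbox u v)"
        by (rule has_integral_bound[OF \<open>e \<ge> 0\<close> 2]) (use that \<open>e \<ge> 0\<close> in auto)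
      then show ?thesis using that(1) by (simp add: mult.commute)
    qed
    show ?thesis
    proof (cases "u \<le> v")
      case True
      then show ?thesis using *[of u v] that by auto
    next
      case False
      then have "\<bar>G u - G v - c * (u - v)\<bar> \<le> e * (u - v)" using that by (intro *) auto
      moreover have "\<bar>G v - G u - c * (v - u)\<bar> = \<bar>G u - G v - c * (u - v)\<bar>"
        by (simp add: algebra_simps abs_if)
      ultimately show ?thesis using False by simp
    qed
  qed
  have "has_delta_derivative T G (\<phi> (snap t)) t" if t: "t \<in> kappa T" for t
    unfolding has_delta_derivative_def
  proof (intro conjI allI impI, fact t)
    fix \<epsilon> :: real assume "\<epsilon> > 0"
    have "t \<in> T" using t kappa_subset by blast
    show "\<exists>\<delta>>0. \<forall>s\<in>T. \<bar>s - t\<bar> < \<delta> \<longrightarrow>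
        \<bar>G (\<sigma> t) - G s - \<phi> (snap t) * (\<sigma> t - s)\<bar> \<le> \<epsilon> * \<bar>\<sigma> t - s\<bar>"
    proof (cases "\<sigma> t = t")
      case True
      obtain d where d: "d > 0"
        "\<And>u. \<bar>u - t\<bar> < d \<and> (t \<le> u \<or> (\<exists>s\<in>T. s \<le> u \<and> \<bar>s - t\<bar> < d)) \<Longrightarrow>
          \<bar>\<phi> (snap u) - \<phi> (snap t)\<bar> < \<epsilon>"
        using rd_right_dense[OF assms \<open>t \<in> T\<close> True \<open>\<epsilon> > 0\<close>] by blast
      show ?thesis
      proof (intro exI[of _ d] conjI ballI impI)
        fix s assume s: "s \<in> T" "\<bar>s - t\<bar> < d"
        have "\<bar>?h u - \<phi> (snap t)\<bar> \<le> \<epsilon>" if u: "min s t \<le> u" "u < max s t" for u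
        proof -
          have "\<bar>u - t\<bar> < d" "t \<le> u \<or> s \<le> u"
            using u s by (auto simp: min_def max_def split: if_splits)
          then have "t \<le> u \<or> (\<exists>s\<in>T. s \<le> u \<and> \<bar>s - t\<bar> < d)" using s by blast
          then show ?thesis using d(2)[of u] \<open>\<bar>u - t\<bar> < d\<close> by (simp add: less_imp_le)
        qed
        then show "\<bar>G (\<sigma> t) - G s - \<phi> (snap t) * (\<sigma> t - s)\<bar> \<le> \<epsilon> * \<bar>\<sigma> t - s\<bar>"
          unfolding True using \<open>\<epsilon> > 0\<close> by (intro est) auto
      qed (fact d)
    next
      case False
      then have j: "t < \<sigma> t" using forward_jump_ge[of t T] by simp
      let ?c = "\<phi> (snap t)"
      obtain M where M: "M \<ge> 0" "\<And>t. t \<in> S \<Longrightarrow> \<bar>\<phi> t\<bar> \<le> M" using rd_bounded[OF assms] by blast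
      have "\<bar>G (\<sigma> t) - G t - ?c * (\<sigma> t - t)\<bar> \<le> 0 * \<bar>\<sigma> t - t\<bar>"
      proof (rule est)
        fix s assume "min t (\<sigma> t) \<le> s" "s < max t (\<sigma> t)"
        then show "\<bar>?h s - ?c\<bar> \<le> 0" using snap_gap[OF \<open>t \<in> T\<close>, of s] j by simp
      qed simp
      then have jump: "G (\<sigma> t) - G t = ?c * (\<sigma> t - t)" by simp
      have h: "\<bar>?h u - ?c\<bar> \<le> 2 * M" for u
        using M(2)[OF snap_in[of u]] M(2)[OF snap_in[of t]] by simp
      \<comment> \<open>The first bound keeps points of \<open>T\<close> near \<open>t\<close> from
        lying to its right; the second makes the error over \<open>[s, t]\<close>, where the
        integrand is off by at most \<open>2 * M\<close>, smaller than \<open>\<epsilon>\<close>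
        times the gap.\<close>
      define d where "d = min (\<sigma> t - t) (\<epsilon> * (\<sigma> t - t) / (2 * M + 1))"
      have d: "d > 0" "d \<le> \<sigma> t - t"
        using j \<open>\<epsilon> > 0\<close> M(1) by (auto simp: d_def)
      have "d * (2 * M + 1) \<le> \<epsilon> * (\<sigma> t - t)"
        using M(1) by (simp add: d_def flip: pos_le_divide_eq)
      then have d3: "2 * M * d \<le> \<epsilon> * (\<sigma> t - t)" using d(1) by (simp add: algebra_simps)
      show ?thesis
      proof (intro exI[of _ d] conjI ballI impI)
        fix s assume s: "s \<in> T" "\<bar>s - t\<bar> < d"
        then have "s \<le> t" using forward_jump_le[OF s(1), of t] d by force
        have "G (\<sigma> t) - G s - ?c * (\<sigma> t - s) = G t - G s - ?c * (t - s)"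
          using jump by (simp add: algebra_simps)
        also have "\<bar>\<dots>\<bar> \<le> 2 * M * \<bar>t - s\<bar>"
          using h M(1) by (intro est) auto
        also have "\<dots> \<le> 2 * M * d" using s M(1) by (intro mult_left_mono) auto
        also note d3
        also have "\<epsilon> * (\<sigma> t - t) \<le> \<epsilon> * \<bar>\<sigma> t - s\<bar>"
          using \<open>\<epsilon> > 0\<close> \<open>s \<le> t\<close> j by (intro mult_left_mono) auto
        finally show "\<bar>G (\<sigma> t) - G s - ?c * (\<sigma> t - s)\<bar> \<le> \<epsilon> * \<bar>\<sigma> t - s\<bar>" .
      qed (fact d)
    qed
  qed
  then show ?thesis using that G by blast
qed

section \<open>Delta integrals of rd-continuous functions\<close>

lemma delta_deriv_T: "has_delta_derivative T f D t \<Longrightarrow> delta_deriv T f t = D"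
  using delta_deriv_eq[OF closed_T a_in b_in] ab by auto

text \<open>The definite description denotes because two antiderivatives differ by a function with
  zero delta derivative, which is constant on \<open>[a,t]\<close>.\<close>

lemma delta_integral_antiderivative:
  assumes G: "\<And>s. s \<in> S \<Longrightarrow> has_delta_derivative T G (\<phi> s) s" and t: "t \<in> S"
  shows "delta_integral T a t \<phi> = G t - G a"
  unfolding delta_integral_def
proof (rule the_equality)
  have sub: "ts_interval T a t \<subseteq> S" using t by (auto simp: ts_interval_def)
  then show "\<exists>F. (\<forall>s\<in>ts_interval T a t \<inter> kappa T. has_delta_derivative T F (\<phi> s) s) \<and> G t - G a = F t - F a"
    using G by blast
  fix I
  assume "\<exists>F. (\<forall>s\<in>ts_interval T a t \<inter> kappa T. has_delta_derivative T F (\<phi> s) s) \<and> I = F t - F a"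
  then obtain F where F: "\<And>s. s \<in> ts_interval T a t \<Longrightarrow> has_delta_derivative T F (\<phi> s) s"
    and I: "I = F t - F a"
    using sub S_kappa by blast
  have "1 * F t + (- 1) * G t = 1 * F a + (- 1) * G a"
  proof (rule has_delta_derivative_zero_const[OF closed_T a_in])
    show "has_delta_derivative T (\<lambda>s. 1 * F s + (- 1) * G s) 0 s" if "s \<in> ts_interval T a t" for s
      using has_delta_derivative_lincomb[OF F[OF that] G, of 1 "- 1"] sub that by auto
  qed (use t in \<open>auto simp: ts_interval_def\<close>)
  then show "I = G t - G a" using I by simp
qed

lemma rd_antiderivative:
  assumes "rd \<phi>"
  obtains G where "\<And>t. t \<in> kappa T \<Longrightarrow> has_delta_derivative T G (\<phi> (snap t)) t"
    and "\<And>s. s \<in> S \<Longrightarrow> has_delta_derivative T G (\<phi> s) s"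
    and "\<And>u v. u \<le> v \<Longrightarrow> ((\<phi> \<circ> snap) has_integral G v - G u) {u..v}"
    and "\<And>t. t \<in> S \<Longrightarrow> delta_integral T a t \<phi> = G t - G a"
proof -
  obtain G where G: "\<And>u v. u \<le> v \<Longrightarrow> ((\<phi> \<circ> snap) has_integral G v - G u) {u..v}"
    "\<And>t. t \<in> kappa T \<Longrightarrow> has_delta_derivative T G (\<phi> (snap t)) t"
    using rd_primitive[OF assms] by blast
  have GS: "has_delta_derivative T G (\<phi> s) s" if "s \<in> S" for s
    using G(2)[OF S_kappa[OF that]] snap_S[OF that] by simp
  show thesis
    by (rule that[OF G(2) GS G(1) delta_integral_antiderivative[OF GS]])
qed

lemma delta_integral_lincomb:
  assumes "rd \<phi>" "rd \<psi>" "t \<in> S"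
  shows "delta_integral T a t (\<lambda>s. c * \<phi> s + d * \<psi> s)
    = c * delta_integral T a t \<phi> + d * delta_integral T a t \<psi>"
proof -
  obtain F where F: "\<And>s. s \<in> S \<Longrightarrow> has_delta_derivative T F (\<phi> s) s"
      "\<And>t. t \<in> S \<Longrightarrow> delta_integral T a t \<phi> = F t - F a"
    using rd_antiderivative[OF assms(1)] by metis
  obtain G where G: "\<And>s. s \<in> S \<Longrightarrow> has_delta_derivative T G (\<psi> s) s"
      "\<And>t. t \<in> S \<Longrightarrow> delta_integral T a t \<psi> = G t - G a"
    using rd_antiderivative[OF assms(2)] by metis
  have "delta_integral T a t (\<lambda>s. c * \<phi> s + d * \<psi> s)
      = (c * F t + d * G t) - (c * F a + d * G a)"
    using F(1) G(1) by (intro delta_integral_antiderivative has_delta_derivative_lincomb assms)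
  then show ?thesis unfolding F(2)[OF assms(3)] G(2)[OF assms(3)] by (simp add: algebra_simps)
qed

lemma delta_integral_zero: "t \<in> S \<Longrightarrow> delta_integral T a t (\<lambda>_. 0) = 0"
  using delta_integral_antiderivative[of "\<lambda>_. 0" "\<lambda>_. 0" t] has_delta_derivative_const[OF S_kappa]
  by simp

lemma delta_integral_sum:
  assumes "\<And>i. i \<in> I \<Longrightarrow> rd (\<phi> i)" "t \<in> S"
  shows "delta_integral T a t (\<lambda>s. \<Sum>i\<in>I. c i * \<phi> i s) = (\<Sum>i\<in>I. c i * delta_integral T a t (\<phi> i))"
  using assms(1)
proof (induction I rule: infinite_finite_induct)
  case (insert i I)
  have "rd (\<lambda>s. \<Sum>i\<in>I. c i * \<phi> i s)"
    using insert.prems by (intro rd_continuous_on_sum rd_continuous_on_mult rd_continuous_on_const) auto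
  then show ?case
    using insert delta_integral_lincomb[of "\<phi> i" _ t "c i" 1] assms(2) by simp
qed (use delta_integral_zero[OF assms(2)] in auto)

lemma delta_integral_cong:
  assumes "rd \<phi>" "\<And>s. s \<in> S \<Longrightarrow> \<phi> s = \<psi> s" "t \<in> S"
  shows "delta_integral T a t \<phi> = delta_integral T a t \<psi>"
proof -
  obtain G where G: "\<And>s. s \<in> S \<Longrightarrow> has_delta_derivative T G (\<phi> s) s"
      "\<And>t. t \<in> S \<Longrightarrow> delta_integral T a t \<phi> = G t - G a"
    using rd_antiderivative[OF assms(1)] by metis
  show ?thesis
    using delta_integral_antiderivative[of G \<psi> t] G assms by simp
qed

lemma delta_integral_bound:
  assumes "rd \<phi>" "\<And>t. t \<in> S \<Longrightarrow> \<bar>\<phi> t\<bar> \<le> M"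
  shows "\<bar>delta_integral T a b \<phi>\<bar> \<le> M * (b - a)"
proof -
  obtain G where G: "\<And>u v. u \<le> v \<Longrightarrow> ((\<phi> \<circ> snap) has_integral G v - G u) {u..v}"
      "\<And>t. t \<in> S \<Longrightarrow> delta_integral T a t \<phi> = G t - G a"
    using rd_antiderivative[OF assms(1)] by metis
  have "M \<ge> 0" using assms(2)[OF aS] by linarith
  have "norm (G b - G a) \<le> M * measure lborel (cbox a b)"
    by (rule has_integral_bound[OF \<open>M \<ge> 0\<close>])
      (use G(1)[of a b] assms(2)[OF snap_in] ab in auto)
  then show ?thesis using G(2)[OF bS] ab by simp
qed

text \<open>At these points \<open>[a,b]\<close>, taken as a time scale of its own, has the same
  jumps as \<open>T\<close>, so delta derivatives restrict to it. At \<open>b\<close> this needs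
  both densities: left density for membership in \<open>kappa S\<close>, and right density because
  the forward jump of \<open>S\<close> at its maximum is \<open>b\<close> by convention.\<close>

lemma determined_pointsD:
  assumes "t \<in> determined_points T a b"
  shows "t \<in> S" "t \<in> kappa S" "forward_jump S t = \<sigma> t"
proof -
  show t: "t \<in> S" using assms by (simp add: determined_points_def)
  have bdd: "bdd_above S" and Sup: "Sup S = b"
    using bS by (auto simp: S_iff intro!: cSup_eq_maximum bdd_aboveI[of _ b])
  show "t \<in> kappa S"
  proof (cases "t < b")
    case True
    then show ?thesis using kappaI[OF t bS] by blast
  next
    case False
    then have "t = b" "backward_jump T b = b"
      using assms t by (auto simp: determined_points_def S_iff)
    have "b \<le> backward_jump S b"
    proof (rule field_le_epsilon)
      fix e :: real assume "e > 0"
      then obtain s where s: "s \<in> T" "s < b" "b - min e (b - a) < s"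
        using left_dense_approx[OF \<open>backward_jump T b = b\<close> a_in ab, of "min e (b - a)"] ab by auto
      then have "s \<in> S" by (auto simp: S_iff)
      from backward_jump_ge[OF this s(2)] s show "b \<le> backward_jump S b + e" by linarith
    qed
    then show ?thesis using bdd Sup t \<open>t = b\<close> by (simp add: kappa_def)
  qed
  show "forward_jump S t = \<sigma> t"
  proof (cases "t < b")
    case False
    then have "t = b" "\<sigma> b = b" using assms t by (auto simp: determined_points_def S_iff)
    then show ?thesis by (auto simp: forward_jump_def S_iff)
  next
    case True
    have "forward_jump S t = Inf {s \<in> S. s > t}"
      using True bS by (auto simp: forward_jump_def)
    moreover have "\<sigma> t \<le> Inf {s \<in> S. s > t}"
      using True bS by (intro cInf_greatest) (auto simp: S_iff intro: forward_jump_le)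
    moreover have "forward_jump S t \<le> \<sigma> t"
    proof (cases "t < \<sigma> t")
      case True
      then show ?thesis using sigma_S[OF t \<open>t < b\<close>] by (intro forward_jump_le)
    next
      case False
      then have st: "\<sigma> t = t" using forward_jump_ge[of t T] by simp
      show ?thesis
      proof (rule field_le_epsilon)
        fix e :: real assume "e > 0"
        then obtain s where s: "s \<in> T" "t < s" "s < t + min e (b - t)"
          using right_dense_approx[OF st b_in True, of "min e (b - t)"] True by auto
        then have "s \<in> S" using t by (auto simp: S_iff)
        from forward_jump_le[OF this s(2)] s st show "forward_jump S t \<le> \<sigma> t + e" by linarith
      qed
    qed
    ultimately show ?thesis by simp
  qed
qed

lemma has_delta_derivative_restrict:
  assumes "has_delta_derivative T f D t" "t \<in> determined_points T a b"
  shows "has_delta_derivative S f D t"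
proof -
  have "S \<subseteq> T" by (auto simp: S_iff)
  note D = determined_pointsD[OF assms(2)]
  show ?thesis
    unfolding has_delta_derivative_def D(3)
    using D(2) has_delta_derivativeD[OF assms(1)] \<open>S \<subseteq> T\<close> by (metis subsetD)
qed

lemma has_delta_derivative_S_unique:
  "has_delta_derivative S f D t \<Longrightarrow> has_delta_derivative S f E t \<Longrightarrow> D = E"
  using has_delta_derivative_unique[OF closed_S aS bS] ab by blast

lemma delta_deriv_S: "has_delta_derivative S f D t \<Longrightarrow> delta_deriv S f t = D"
  using delta_deriv_eq[OF closed_S aS bS] ab by auto

text \<open>The primitive \<open>G\<close> is nondecreasing with equal values at \<open>a\<close>
  and \<open>b\<close>, hence constant on \<open>S\<close>. At a determined point both 0 and
  \<open>\<phi> t\<close> are then its delta derivative within \<open>S\<close>, and uniqueness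
  decides.\<close>

lemma nonneg_delta_integral_zero:
  assumes "rd \<phi>" "\<And>t. t \<in> S \<Longrightarrow> \<phi> t \<ge> 0" "delta_integral T a b \<phi> = 0"
    and t: "t \<in> determined_points T a b"
  shows "\<phi> t = 0"
proof -
  obtain G where G: "\<And>s. s \<in> S \<Longrightarrow> has_delta_derivative T G (\<phi> s) s"
      "\<And>u v. u \<le> v \<Longrightarrow> ((\<phi> \<circ> snap) has_integral G v - G u) {u..v}"
      "\<And>t. t \<in> S \<Longrightarrow> delta_integral T a t \<phi> = G t - G a"
    using rd_antiderivative[OF assms(1)] by metis
  have mono: "G u \<le> G v" if "u \<le> v" for u v
    using has_integral_nonneg[OF G(2)[OF that]] assms(2) snap_in by auto
  have G0: "G s = G a" if "s \<in> S" for s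
    using mono[of a s] mono[of s b] G(3)[OF bS] assms(3) that by (auto simp: S_iff)
  note D = determined_pointsD[OF t]
  have "\<sigma> t \<in> S" using forward_jump_in[OF closed_S D(1)] D(3) by simp
  then have "has_delta_derivative S G 0 t"
    using D G0 by (auto simp: has_delta_derivative_def intro!: exI[of _ 1])
  moreover have "has_delta_derivative S G (\<phi> t) t"
    using has_delta_derivative_restrict[OF G(1)[OF D(1)] t] .
  ultimately show ?thesis using has_delta_derivative_S_unique by blast
qed

section \<open>Functions of class \<open>C1rd\<close> and the du Bois-Reymond lemma\<close>

lemma C1rdD:
  assumes "x \<in> C1rd T"
  shows "t \<in> kappa T \<Longrightarrow> has_delta_derivative T x (delta_deriv T x t) t"
    and "rd (delta_deriv T x)"
    and "rd (\<lambda>t. x (\<sigma> t))"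
proof -
  show D: "has_delta_derivative T x (delta_deriv T x t) t" if "t \<in> kappa T" for t
    using assms delta_deriv_T that unfolding C1rd_def delta_differentiable_def by blast
  show "rd (delta_deriv T x)"
    using assms S_kappa unfolding C1rd_def by (auto intro: rd_continuous_on_subset)
  show "rd (\<lambda>t. x (\<sigma> t))"
    unfolding rd_continuous_on_def
  proof (intro ballI conjI impI)
    fix t assume t: "t \<in> S"
    have near: "\<exists>d>0. \<forall>s\<in>T. \<bar>s - t\<bar> < d \<longrightarrow> \<bar>x s - x t\<bar> < e" if "e > 0" for e
      using has_delta_derivative_continuous[OF D[OF S_kappa[OF t]]] that
      unfolding continuous_within_eps_delta dist_real_def by blast
    \<comment> \<open>For \<open>s < t\<close> the jump \<open>\<sigma> s\<close> stays between
      \<open>s\<close> and \<open>t\<close>, so the left-sided limit of \<open>x\<close> after the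
      jump is \<open>x t\<close>, also where \<open>\<sigma> t > t\<close>.\<close>
    have left: "\<exists>d>0. \<forall>s\<in>T. t - d < s \<and> s < t \<longrightarrow> \<bar>x (\<sigma> s) - x t\<bar> < e" if "e > 0" for e
    proof -
      obtain d where d: "d > 0" "\<And>s. s \<in> T \<Longrightarrow> \<bar>s - t\<bar> < d \<Longrightarrow> \<bar>x s - x t\<bar> < e"
        using near[OF \<open>e > 0\<close>] by blast
      have "\<bar>x (\<sigma> s) - x t\<bar> < e" if "s \<in> T" "t - d < s" "s < t" for s
        using forward_jump_le[of t T s] forward_jump_ge[of s T] that t
        by (intro d(2) forward_jump_in closed_T) (auto simp: S_iff)
      then show ?thesis using d(1) by blast
    qed
    show "continuous (at t within S) (\<lambda>t. x (\<sigma> t))" if dense: "\<sigma> t = t"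
      unfolding continuous_within_eps_delta dist_real_def dense
    proof (intro allI impI)
      fix e :: real assume "e > 0"
      obtain d where d: "d > 0" "\<And>s. s \<in> T \<Longrightarrow> \<bar>s - t\<bar> < d \<Longrightarrow> \<bar>x s - x t\<bar> < e"
        using near[OF \<open>e > 0\<close>] by blast
      obtain d' where d': "d' > 0" "\<And>s. s \<in> T \<Longrightarrow> t - d' < s \<Longrightarrow> s < t \<Longrightarrow> \<bar>x (\<sigma> s) - x t\<bar> < e"
        using left[OF \<open>e > 0\<close>] by blast
      \<comment> \<open>To the right of \<open>t\<close> the point \<open>u\<close> caps the jumps:
        \<open>\<sigma> s \<le> u\<close> for every \<open>s\<close> below \<open>u\<close>.\<close>
      obtain u where u: "u \<in> T" "t < u" "u < t + d"
        using right_dense_approx[OF dense B_in _ d(1)] t bB by (auto simp: S_iff)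
      have "\<bar>x (\<sigma> s) - x t\<bar> < e" if "s \<in> S" "\<bar>s - t\<bar> < min d' (u - t)" for s
      proof (cases s t rule: linorder_cases)
        case less
        then show ?thesis using that by (intro d') (auto simp: S_iff)
      next
        case equal
        then show ?thesis using dense \<open>e > 0\<close> by simp
      next
        case greater
        then show ?thesis
          using forward_jump_le[OF u(1), of s] forward_jump_ge[of s T] that u
          by (intro d(2) forward_jump_in closed_T) (auto simp: S_iff)
      qed
      then show "\<exists>d>0. \<forall>s\<in>S. \<bar>s - t\<bar> < d \<longrightarrow> \<bar>x (\<sigma> s) - x t\<bar> < e"
        using d'(1) u(2) by (intro exI[of _ "min d' (u - t)"]) auto
    qed
    have "((\<lambda>t. x (\<sigma> t)) \<longlongrightarrow> x t) (at t within S \<inter> {..<t})"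
      unfolding Lim_within dist_real_def
    proof (intro allI impI)
      fix e :: real assume "e > 0"
      obtain d where d: "d > 0" "\<And>s. s \<in> T \<Longrightarrow> t - d < s \<Longrightarrow> s < t \<Longrightarrow> \<bar>x (\<sigma> s) - x t\<bar> < e"
        using left[OF \<open>e > 0\<close>] by blast
      then show "\<exists>d>0. \<forall>s\<in>S \<inter> {..<t}. 0 < \<bar>s - t\<bar> \<and> \<bar>s - t\<bar> < d \<longrightarrow> \<bar>x (\<sigma> s) - x t\<bar> < e"
        by (intro exI[of _ d]) (auto simp: S_iff)
    qed
    then show "\<exists>l. ((\<lambda>t. x (\<sigma> t)) \<longlongrightarrow> l) (at t within S \<inter> {..<t})" ..
  qed
qed

lemma C1rdI:
  assumes "\<And>t. t \<in> kappa T \<Longrightarrow> has_delta_derivative T x (x' t) t" "rd_continuous_on T (kappa T) x'"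
  shows "x \<in> C1rd T"
  using assms(1) rd_continuous_on_cong[OF assms(2)] delta_deriv_T[OF assms(1), symmetric]
  unfolding C1rd_def delta_differentiable_def by blast

lemma C1rd_lincomb:
  assumes "x \<in> C1rd T" "y \<in> C1rd T"
  shows "(\<lambda>t. c * x t + d * y t) \<in> C1rd T"
    and "t \<in> kappa T \<Longrightarrow> delta_deriv T (\<lambda>t. c * x t + d * y t) t = c * delta_deriv T x t + d * delta_deriv T y t"
proof -
  note D = has_delta_derivative_lincomb[OF C1rdD(1)[OF assms(1)] C1rdD(1)[OF assms(2)]]
  show "(\<lambda>t. c * x t + d * y t) \<in> C1rd T"
    by (rule C1rdI[OF D rd_continuous_on_lincomb]) (use assms in \<open>auto simp: C1rd_def\<close>)
  show "delta_deriv T (\<lambda>t. c * x t + d * y t) t = c * delta_deriv T x t + d * delta_deriv T y t"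
    if "t \<in> kappa T"
    by (rule delta_deriv_T[OF D]) (use that in auto)
qed

text \<open>Membership of a test function in \<open>C1rd T\<close> demands an rd-continuous
  derivative on all of \<open>kappa T\<close>, whereas the integrands are controlled on
  \<open>[a,b]\<close> only.\<close>

lemma rd_continuous_on_snap:
  assumes "rd \<phi>"
  shows "rd_continuous_on T (kappa T) (\<phi> \<circ> snap)"
  unfolding rd_continuous_on_def
proof (intro ballI conjI impI)
  fix t assume "t \<in> kappa T"
  then have "t \<in> T" using kappa_subset by blast
  show "continuous (at t within kappa T) (\<phi> \<circ> snap)" if "\<sigma> t = t"
    using rd_tendsto_right(1)[OF assms \<open>t \<in> T\<close> that] kappa_subset continuous_within_subset by blast
  obtain l where "((\<phi> \<circ> snap) \<longlongrightarrow> l) (at_left t)"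
    using rd_regulated[OF assms] by (auto simp: regulated_def)
  then have "((\<phi> \<circ> snap) \<longlongrightarrow> l) (at t within kappa T \<inter> {..<t})"
    by (rule tendsto_within_subset) auto
  then show "\<exists>l. ((\<phi> \<circ> snap) \<longlongrightarrow> l) (at t within kappa T \<inter> {..<t})" ..
qed

text \<open>Integration by parts replaces \<open>p\<close> by its antiderivative \<open>Y\<close>.
  The test function is the primitive of \<open>q - Y\<close> minus the mean value of
  \<open>q - Y\<close>; for it the hypothesis says that the integral of a square vanishes.\<close>

lemma du_Bois_Reymond:
  assumes p: "rd p" and q: "rd q"
    and vanish: "\<And>\<eta>. \<eta> \<in> C1rd T \<Longrightarrow> \<eta> a = 0 \<Longrightarrow> \<eta> b = 0 \<Longrightarrow>
      delta_integral T a b (\<lambda>t. p t * \<eta> (\<sigma> t) + q t * delta_deriv T \<eta> t) = 0"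
  shows "\<exists>c. \<forall>t\<in>determined_points T a b. q t - delta_integral T a t p = c"
proof -
  obtain Y where Y: "\<And>s. s \<in> S \<Longrightarrow> has_delta_derivative T Y (p s) s"
      "\<And>t. t \<in> S \<Longrightarrow> delta_integral T a t p = Y t - Y a"
    using rd_antiderivative[OF p] by metis
  have rdY: "rd Y"
  proof (rule rd_continuous_on_continuous)
    show "continuous (at t within S) Y" if "t \<in> S" for t
      using has_delta_derivative_continuous[OF Y(1)[OF that]]
      by (rule continuous_within_subset) (auto simp: S_iff)
  qed
  define M where "M t = 1 * q t + (- 1) * Y t" for t
  have rdM: "rd M" unfolding M_def by (intro rd_continuous_on_lincomb q rdY)
  \<comment> \<open>Subtracting the mean value makes the primitive of \<open>\<phi>\<close> return
    to its initial value, so that \<open>\<eta> b = 0\<close>.\<close>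
  define c where "c = delta_integral T a b M / (b - a)"
  define \<phi> where "\<phi> t = 1 * M t + (- c) * 1" for t
  have rd\<phi>: "rd \<phi>" unfolding \<phi>_def by (intro rd_continuous_on_lincomb rdM rd_continuous_on_const)
  have one: "delta_integral T a b (\<lambda>_. 1) = b - a"
    by (rule delta_integral_antiderivative[OF _ bS])
      (auto simp: has_delta_derivative_def S_kappa intro: exI[of _ 1])
  have I\<phi>: "delta_integral T a b \<phi> = 0"
    using delta_integral_lincomb[OF rdM rd_continuous_on_const bS, of 1 "- c" 1] ab
    by (simp add: one \<phi>_def[abs_def] c_def)
  obtain G where G: "\<And>t. t \<in> kappa T \<Longrightarrow> has_delta_derivative T G (\<phi> (snap t)) t"
      "\<And>t. t \<in> S \<Longrightarrow> delta_integral T a t \<phi> = G t - G a"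
    using rd_antiderivative[OF rd\<phi>] by metis
  define \<eta> where "\<eta> t = 1 * G t + (- G a) * 1" for t
  have D\<eta>: "has_delta_derivative T \<eta> (\<phi> (snap t)) t" if "t \<in> kappa T" for t
    using has_delta_derivative_lincomb[OF G(1)[OF that] has_delta_derivative_const[OF that, of 1], of 1 "- G a"]
    by (simp add: \<eta>_def[abs_def])
  have \<eta>: "\<eta> \<in> C1rd T"
    using C1rdI[OF D\<eta>] rd_continuous_on_snap[OF rd\<phi>] by (simp add: comp_def)
  have \<eta>ab: "\<eta> a = 0" "\<eta> b = 0" using G(2)[OF bS] I\<phi> by (auto simp: \<eta>_def)
  have \<eta>': "delta_deriv T \<eta> t = \<phi> t" if "t \<in> S" for t
    using delta_deriv_T[OF D\<eta>[OF S_kappa[OF that]]] snap_S[OF that] by simp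
  note rds = rd_continuous_on_add rd_continuous_on_mult p q rdY C1rdD(2,3)[OF \<eta>] rd\<phi>
  \<comment> \<open>The integrand is the delta derivative of the product of \<open>Y\<close> and
    \<open>\<eta>\<close>, whose values at \<open>a\<close> and \<open>b\<close> vanish.\<close>
  have parts: "delta_integral T a b (\<lambda>t. p t * \<eta> (\<sigma> t) + Y t * delta_deriv T \<eta> t) = 0"
    using delta_integral_antiderivative[OF has_delta_derivative_mult[OF Y(1) C1rdD(1)[OF \<eta>]] bS]
      S_kappa \<eta>ab by auto
  \<comment> \<open>One factor \<open>\<phi>\<close> is the derivative of \<open>\<eta>\<close>, the
    other is expanded as \<open>q - Y - c\<close>. The terms with \<open>p\<close> cancel; they are
    inserted so that each of the three integrals is known to vanish.\<close>
  have "delta_integral T a b (\<lambda>t. \<phi> t * \<phi> t)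
      = delta_integral T a b (\<lambda>t. 1 * (1 * (p t * \<eta> (\<sigma> t) + q t * delta_deriv T \<eta> t)
          + (- 1) * (p t * \<eta> (\<sigma> t) + Y t * delta_deriv T \<eta> t)) + (- c) * \<phi> t)"
    by (rule delta_integral_cong[OF _ _ bS]) (intro rds, simp add: \<eta>' \<phi>_def M_def algebra_simps)
  also have "\<dots> = 0"
    using vanish[OF \<eta> \<eta>ab] parts I\<phi>
    by (subst delta_integral_lincomb[OF _ _ bS], (intro rds rd_continuous_on_const)+)
      (subst delta_integral_lincomb[OF _ _ bS], (intro rds)+, simp)
  finally have "\<phi> t * \<phi> t = 0" if "t \<in> determined_points T a b" for t
    using that by (intro nonneg_delta_integral_zero[of "\<lambda>t. \<phi> t * \<phi> t"] rds) auto
  then have "q t - delta_integral T a t p = c + Y a" if "t \<in> determined_points T a b" for t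
    using that Y(2)[OF determined_pointsD(1)[OF that]] by (auto simp: \<phi>_def M_def)
  then show ?thesis by blast
qed

section \<open>First variations along two-parameter perturbations\<close>

definition variation :: "(real \<Rightarrow> real \<Rightarrow> real \<Rightarrow> real) \<Rightarrow> (real \<Rightarrow> real \<Rightarrow> real \<Rightarrow> real) \<Rightarrow>
    (real \<Rightarrow> real) \<Rightarrow> (real \<Rightarrow> real) \<Rightarrow> real \<Rightarrow> real" where
  "variation fy fv x \<eta> t = along T x fy t * \<eta> (\<sigma> t) + along T x fv t * delta_deriv T \<eta> t"

text \<open>The factors \<open>1\<close> make this literally an instance of the lemmas on linear combinations.\<close>

definition perturb :: "(real \<Rightarrow> real) \<Rightarrow> (real \<Rightarrow> real) \<Rightarrow> (real \<Rightarrow> real) \<Rightarrow> real \<times> real \<Rightarrow> real \<Rightarrow> real" where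
  "perturb x \<eta>1 \<eta>2 p t = 1 * x t + 1 * (fst p * \<eta>1 t + snd p * \<eta>2 t)"

lemma perturb_C1rd:
  assumes "x \<in> C1rd T" "\<eta>1 \<in> C1rd T" "\<eta>2 \<in> C1rd T"
  shows "perturb x \<eta>1 \<eta>2 p \<in> C1rd T"
    and "t \<in> S \<Longrightarrow> delta_deriv T (perturb x \<eta>1 \<eta>2 p) t
      = delta_deriv T x t + (fst p * delta_deriv T \<eta>1 t + snd p * delta_deriv T \<eta>2 t)"
proof -
  note L = C1rd_lincomb(1)[OF assms(2,3), of "fst p" "snd p"]
  show "perturb x \<eta>1 \<eta>2 p \<in> C1rd T"
    unfolding perturb_def[abs_def] by (rule C1rd_lincomb(1)[OF assms(1) L])
  show "delta_deriv T (perturb x \<eta>1 \<eta>2 p) t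
      = delta_deriv T x t + (fst p * delta_deriv T \<eta>1 t + snd p * delta_deriv T \<eta>2 t)" if "t \<in> S"
    unfolding perturb_def[abs_def]
    using C1rd_lincomb(2)[OF assms(1) L S_kappa[OF that], of 1 1]
      C1rd_lincomb(2)[OF assms(2,3) S_kappa[OF that], of "fst p" "snd p"] by simp
qed

lemma perturb_0: "perturb x \<eta>1 \<eta>2 0 = x"
  by (simp add: perturb_def fun_eq_iff)

lemma C1rd_bounded:
  assumes "x \<in> C1rd T"
  obtains M where "M \<ge> 0" "\<And>t. t \<in> S \<Longrightarrow> \<bar>x (\<sigma> t)\<bar> \<le> M" "\<And>t. t \<in> S \<Longrightarrow> \<bar>delta_deriv T x t\<bar> \<le> M"
proof -
  obtain M1 where M1: "M1 \<ge> 0" "\<And>t. t \<in> S \<Longrightarrow> \<bar>x (\<sigma> t)\<bar> \<le> M1"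
    using rd_bounded[OF C1rdD(3)[OF assms]] by blast
  obtain M2 where M2: "M2 \<ge> 0" "\<And>t. t \<in> S \<Longrightarrow> \<bar>delta_deriv T x t\<bar> \<le> M2"
    using rd_bounded[OF C1rdD(2)[OF assms]] by blast
  show thesis by (rule that[of "max M1 M2"]) (use M1 M2 in \<open>auto simp: le_max_iff_disj\<close>)
qed

lemma plane_bound:
  fixes p :: "real \<times> real"
  assumes "\<bar>u\<bar> \<le> M1" "\<bar>v\<bar> \<le> M2"
  shows "\<bar>fst p * u + snd p * v\<bar> \<le> (M1 + M2) * norm p"
proof -
  have "\<bar>fst p\<bar> \<le> norm p" "\<bar>snd p\<bar> \<le> norm p"
    by (metis norm_fst_le norm_snd_le prod.collapse real_norm_def)+
  then have "\<bar>fst p * u\<bar> \<le> norm p * M1" "\<bar>snd p * v\<bar> \<le> norm p * M2"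
    using assms unfolding abs_mult by (auto intro!: mult_mono)
  then show ?thesis by (simp add: algebra_simps)
qed

text \<open>The remainder is itself a delta integral, and its integrand is bounded uniformly in
  \<open>t\<close> by \<open>regular_integrand_estimate\<close>, as \<open>x\<close> and its
  derivative stay bounded on \<open>[a,b]\<close>.\<close>

lemma integral_functional_has_derivative:
  assumes f: "regular_integrand T a b f fy fv"
    and x: "x \<in> C1rd T" "\<eta>1 \<in> C1rd T" "\<eta>2 \<in> C1rd T"
  shows "((\<lambda>p. delta_integral T a b (along T (perturb x \<eta>1 \<eta>2 p) f)) has_derivative
    (\<lambda>p. fst p * delta_integral T a b (variation fy fv x \<eta>1)
       + snd p * delta_integral T a b (variation fy fv x \<eta>2))) (at 0)"
  unfolding has_derivative_at_alt
proof (intro conjI allI impI)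
  let ?A = "\<lambda>p. along T (perturb x \<eta>1 \<eta>2 p) f" and ?V = "variation fy fv x"
  show "bounded_linear (\<lambda>p. fst p * delta_integral T a b (?V \<eta>1) + snd p * delta_integral T a b (?V \<eta>2))"
    by (intro bounded_linear_add bounded_linear_mult_const bounded_linear_fst bounded_linear_snd)
  have rdx: "rd (along T y \<phi>)" if "y \<in> C1rd T" "\<phi> \<in> {f, fy, fv}" for y \<phi>
    using f that unfolding regular_integrand_def by blast
  have rdA: "rd (?A p)" for p by (rule rdx) (use perturb_C1rd[OF x] in auto)
  have rdV: "rd (?V \<eta>)" if "\<eta> \<in> C1rd T" for \<eta>
    unfolding variation_def[abs_def]
    by (intro rd_continuous_on_add rd_continuous_on_mult rdx x C1rdD that) auto
  obtain R where R: "\<And>t. t \<in> S \<Longrightarrow> \<bar>x (\<sigma> t)\<bar> \<le> R" "\<And>t. t \<in> S \<Longrightarrow> \<bar>delta_deriv T x t\<bar> \<le> R"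
    using C1rd_bounded[OF x(1)] by metis
  obtain M1 where M1: "M1 \<ge> 0" "\<And>t. t \<in> S \<Longrightarrow> \<bar>\<eta>1 (\<sigma> t)\<bar> \<le> M1" "\<And>t. t \<in> S \<Longrightarrow> \<bar>delta_deriv T \<eta>1 t\<bar> \<le> M1"
    using C1rd_bounded[OF x(2)] by metis
  obtain M2 where M2: "M2 \<ge> 0" "\<And>t. t \<in> S \<Longrightarrow> \<bar>\<eta>2 (\<sigma> t)\<bar> \<le> M2" "\<And>t. t \<in> S \<Longrightarrow> \<bar>delta_deriv T \<eta>2 t\<bar> \<le> M2"
    using C1rd_bounded[OF x(3)] by metis
  define M where "M = M1 + M2 + 1"
  have "M > 0" using M1 M2 by (simp add: M_def)
  fix e :: real assume "e > 0"
  \<comment> \<open>The two increments of the arguments are each at most \<open>M * norm p\<close>,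
    and integration contributes the factor \<open>b - a\<close>.\<close>
  define \<epsilon> where "\<epsilon> = e / (2 * M * (b - a))"
  have "\<epsilon> > 0" using \<open>e > 0\<close> \<open>M > 0\<close> ab by (simp add: \<epsilon>_def)
  obtain d where d: "d > 0" "\<And>t y v h w. t \<in> S \<Longrightarrow> \<bar>y\<bar> \<le> R \<Longrightarrow> \<bar>v\<bar> \<le> R \<Longrightarrow> \<bar>h\<bar> < d \<Longrightarrow> \<bar>w\<bar> < d \<Longrightarrow>
      \<bar>f t (y + h) (v + w) - f t y v - (fy t y v * h + fv t y v * w)\<bar> \<le> \<epsilon> * (\<bar>h\<bar> + \<bar>w\<bar>)"
    using regular_integrand_estimate[OF f \<open>\<epsilon> > 0\<close>, of R] by metis
  have main: "\<bar>delta_integral T a b (?A p) - delta_integral T a b (?A 0)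
      - (fst p * delta_integral T a b (?V \<eta>1) + snd p * delta_integral T a b (?V \<eta>2))\<bar> \<le> e * norm p"
    if p: "norm p < d / M" for p
  proof -
    let ?D = "\<lambda>t. 1 * (1 * ?A p t + (- 1) * ?A 0 t) + (- 1) * (fst p * ?V \<eta>1 t + snd p * ?V \<eta>2 t)"
    have "delta_integral T a b (?A p) - delta_integral T a b (?A 0)
        - (fst p * delta_integral T a b (?V \<eta>1) + snd p * delta_integral T a b (?V \<eta>2))
        = delta_integral T a b ?D"
      using delta_integral_lincomb[OF rd_continuous_on_lincomb[OF rdA[of p] rdA[of 0]]
          rd_continuous_on_lincomb[OF rdV[OF x(2)] rdV[OF x(3)]] bS, of 1 1 "- 1" "- 1" "fst p" "snd p"]
        delta_integral_lincomb[OF rdA[of p] rdA[of 0] bS, of 1 "- 1"]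
        delta_integral_lincomb[OF rdV[OF x(2)] rdV[OF x(3)] bS, of "fst p" "snd p"]
      by simp
    also have "\<bar>\<dots>\<bar> \<le> (\<epsilon> * (2 * M * norm p)) * (b - a)"
    proof (rule delta_integral_bound)
      show "rd ?D" by (intro rd_continuous_on_lincomb rdA rdV x)
      fix t assume t: "t \<in> S"
      define h where "h = fst p * \<eta>1 (\<sigma> t) + snd p * \<eta>2 (\<sigma> t)"
      define w where "w = fst p * delta_deriv T \<eta>1 t + snd p * delta_deriv T \<eta>2 t"
      have hM: "\<bar>h\<bar> \<le> M * norm p" "\<bar>w\<bar> \<le> M * norm p"
        using plane_bound[OF M1(2)[OF t] M2(2)[OF t], of p] plane_bound[OF M1(3)[OF t] M2(3)[OF t], of p]
        by (auto simp: h_def w_def M_def algebra_simps intro: order_trans)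
      have hd: "\<bar>h\<bar> < d" "\<bar>w\<bar> < d" using hM p \<open>M > 0\<close> by (auto simp: field_simps)
      let ?y = "x (\<sigma> t)" and ?v = "delta_deriv T x t"
      have "?D t = f t (?y + h) (?v + w) - f t ?y ?v - (fy t ?y ?v * h + fv t ?y ?v * w)"
        unfolding along_def variation_def perturb_0 perturb_C1rd(2)[OF x t]
        by (simp add: perturb_def h_def w_def algebra_simps)
      also have "\<bar>\<dots>\<bar> \<le> \<epsilon> * (\<bar>h\<bar> + \<bar>w\<bar>)" by (intro d t R hd)
      also have "\<dots> \<le> \<epsilon> * (2 * M * norm p)" using hM \<open>\<epsilon> > 0\<close> by (intro mult_left_mono) auto
      finally show "\<bar>?D t\<bar> \<le> \<epsilon> * (2 * M * norm p)" .
    qed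
    also have "\<dots> = e * norm p" using \<open>M > 0\<close> ab by (simp add: \<epsilon>_def)
    finally show ?thesis .
  qed
  show "\<exists>d>0. \<forall>p. norm (p - 0) < d \<longrightarrow> norm (delta_integral T a b (?A p) - delta_integral T a b (?A 0)
      - (fst (p - 0) * delta_integral T a b (?V \<eta>1) + snd (p - 0) * delta_integral T a b (?V \<eta>2)))
      \<le> e * norm (p - 0)"
    using main d(1) \<open>M > 0\<close> by (intro exI[of _ "d / M"]) auto
qed

definition composite_variation ::
    "('n::finite \<Rightarrow> real ^ 'n \<Rightarrow> real) \<Rightarrow> ('n \<Rightarrow> real \<Rightarrow> real \<Rightarrow> real \<Rightarrow> real) \<Rightarrow>
     ('n \<Rightarrow> real \<Rightarrow> real \<Rightarrow> real \<Rightarrow> real) \<Rightarrow> ('n \<Rightarrow> real \<Rightarrow> real \<Rightarrow> real \<Rightarrow> real) \<Rightarrow>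
     (real \<Rightarrow> real) \<Rightarrow> (real \<Rightarrow> real) \<Rightarrow> real" where
  "composite_variation H' f fy fv x \<eta> =
     (\<Sum>i\<in>UNIV. H' i (integral_functionals T a b f x) * delta_integral T a b (variation (fy i) (fv i) x \<eta>))"

lemma composite_has_derivative:
  fixes H :: "real ^ 'n::finite \<Rightarrow> real"
  assumes H: "has_continuous_partials H H'" and f: "\<And>i. regular_integrand T a b (f i) (fy i) (fv i)"
    and x: "x \<in> C1rd T" "\<eta>1 \<in> C1rd T" "\<eta>2 \<in> C1rd T"
  shows "((\<lambda>p. H (integral_functionals T a b f (perturb x \<eta>1 \<eta>2 p))) has_derivative
    (\<lambda>p. fst p * composite_variation H' f fy fv x \<eta>1 + snd p * composite_variation H' f fy fv x \<eta>2)) (at 0)"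
proof -
  have "((\<lambda>p. integral_functionals T a b f (perturb x \<eta>1 \<eta>2 p)) has_derivative
      (\<lambda>p. \<chi> i. fst p * delta_integral T a b (variation (fy i) (fv i) x \<eta>1)
         + snd p * delta_integral T a b (variation (fy i) (fv i) x \<eta>2))) (at 0)"
    unfolding integral_functionals_def
    by (intro has_derivative_vec_lambda integral_functional_has_derivative f x)
  from has_derivative_compose[OF this continuous_partials_has_derivative[OF H]] show ?thesis
    unfolding composite_variation_def perturb_0
    by (simp add: algebra_simps sum.distrib sum_distrib_left)
qed

text \<open>The derivative is computed at the origin only. Perturbing an already perturbed function
  amounts to a translation in the plane, so the result at the origin gives continuity
  everywhere.\<close>

lemma composite_continuous:
  fixes H :: "real ^ 'n::finite \<Rightarrow> real"
  assumes H: "has_continuous_partials H H'" and f: "\<And>i. regular_integrand T a b (f i) (fy i) (fv i)"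
    and x: "x \<in> C1rd T" "\<eta>1 \<in> C1rd T" "\<eta>2 \<in> C1rd T"
  shows "isCont (\<lambda>p. H (integral_functionals T a b f (perturb x \<eta>1 \<eta>2 p))) p"
proof -
  have eq: "perturb (perturb x \<eta>1 \<eta>2 p) \<eta>1 \<eta>2 h = perturb x \<eta>1 \<eta>2 (p + h)" for h
    by (simp add: perturb_def fun_eq_iff algebra_simps)
  have "isCont (\<lambda>h. H (integral_functionals T a b f (perturb x \<eta>1 \<eta>2 (p + h)))) 0"
    using has_derivative_continuous[OF composite_has_derivative[where f = f and fy = fy and fv = fv, OF H f perturb_C1rd(1)[OF x, of p] x(2,3)]]
    unfolding eq .
  then show ?thesis unfolding isCont_def by (simp add: LIM_offset_zero_iff)
qed

text \<open>Brings the first variation into the form treated by \<open>du_Bois_Reymond\<close>, with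
  the partial derivatives of the outer function as constant weights.\<close>

lemma composite_variation_eq:
  fixes f :: "'n::finite \<Rightarrow> real \<Rightarrow> real \<Rightarrow> real \<Rightarrow> real"
  assumes f: "\<And>i. regular_integrand T a b (f i) (fy i) (fv i)" and x: "x \<in> C1rd T" "\<eta> \<in> C1rd T"
  shows "composite_variation H' f fy fv x \<eta> = delta_integral T a b (\<lambda>t.
    (\<Sum>i\<in>UNIV. H' i (integral_functionals T a b f x) * along T x (fy i) t) * \<eta> (\<sigma> t)
    + (\<Sum>i\<in>UNIV. H' i (integral_functionals T a b f x) * along T x (fv i) t) * delta_deriv T \<eta> t)"
proof -
  have rdx: "rd (along T x (fy i))" "rd (along T x (fv i))" for i
    using f[of i] x(1) unfolding regular_integrand_def by blast+
  have "rd (variation (fy i) (fv i) x \<eta>)" for i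
    unfolding variation_def[abs_def]
    by (intro rd_continuous_on_add rd_continuous_on_mult rdx C1rdD x)
  from delta_integral_sum[OF this bS, where c = "\<lambda>i. H' i (integral_functionals T a b f x)"]
  show ?thesis
    unfolding composite_variation_def
    by (simp add: variation_def sum_distrib_right sum.distrib distrib_left mult.assoc)
qed

lemma c1_norm_le:
  assumes "\<And>t. t \<in> S \<Longrightarrow> \<bar>x (\<sigma> t)\<bar> \<le> M" "\<And>t. t \<in> S \<Longrightarrow> \<bar>delta_deriv T x t\<bar> \<le> N"
  shows "c1_norm T a b x \<le> M + N"
  unfolding c1_norm_def using aS assms by (intro add_mono cSUP_least) auto

lemma perturb_c1_norm:
  assumes x: "x \<in> C1rd T" "\<eta>1 \<in> C1rd T" "\<eta>2 \<in> C1rd T" and "\<delta> > 0"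
  obtains d where "d > 0" "\<And>p. norm p < d \<Longrightarrow> c1_norm T a b (\<lambda>t. perturb x \<eta>1 \<eta>2 p t - x t) < \<delta>"
proof -
  obtain M1 where M1: "M1 \<ge> 0" "\<And>t. t \<in> S \<Longrightarrow> \<bar>\<eta>1 (\<sigma> t)\<bar> \<le> M1" "\<And>t. t \<in> S \<Longrightarrow> \<bar>delta_deriv T \<eta>1 t\<bar> \<le> M1"
    using C1rd_bounded[OF x(2)] by metis
  obtain M2 where M2: "M2 \<ge> 0" "\<And>t. t \<in> S \<Longrightarrow> \<bar>\<eta>2 (\<sigma> t)\<bar> \<le> M2" "\<And>t. t \<in> S \<Longrightarrow> \<bar>delta_deriv T \<eta>2 t\<bar> \<le> M2"
    using C1rd_bounded[OF x(3)] by metis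
  \<comment> \<open>Each of the two suprema in the norm contributes
    \<open>(M1 + M2) * norm p\<close>; the summand 1 makes \<open>M\<close> positive.\<close>
  define M where "M = 2 * (M1 + M2) + 1"
  have "M > 0" using M1 M2 by (simp add: M_def)
  show thesis
  proof (rule that)
    show "\<delta> / M > 0" using \<open>\<delta> > 0\<close> \<open>M > 0\<close> by simp
    fix p :: "real \<times> real" assume p: "norm p < \<delta> / M"
    have diff: "(\<lambda>t. perturb x \<eta>1 \<eta>2 p t - x t) = (\<lambda>t. fst p * \<eta>1 t + snd p * \<eta>2 t)"
      by (simp add: perturb_def fun_eq_iff)
    have "c1_norm T a b (\<lambda>t. perturb x \<eta>1 \<eta>2 p t - x t) \<le> (M1 + M2) * norm p + (M1 + M2) * norm p"
      unfolding diff
      by (rule c1_norm_le) (simp_all only: C1rd_lincomb(2)[OF x(2,3) S_kappa] plane_bound M1 M2)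
    also have "\<dots> \<le> M * norm p" by (simp add: M_def algebra_simps)
    also have "\<dots> < \<delta>" using p \<open>M > 0\<close> by (simp add: field_simps)
    finally show "c1_norm T a b (\<lambda>t. perturb x \<eta>1 \<eta>2 p t - x t) < \<delta>" .
  qed
qed

end

section \<open>Extremizers and the Euler-Lagrange equation\<close>

lemma extremizerE:
  assumes "extremizer T a b xa xb K k L xt"
  obtains s :: real and \<delta> where "\<bar>s\<bar> = 1" "admissible T a b xa xb K k xt" "\<delta> > 0"
    "\<And>x. admissible T a b xa xb K k x \<Longrightarrow> c1_norm T a b (\<lambda>t. x t - xt t) < \<delta> \<Longrightarrow> s * L xt \<le> s * L x"
  using assms unfolding extremizer_def
proof
  assume "weak_local_minimizer T a b xa xb K k L xt"
  then show thesis using that[of 1] unfolding weak_local_minimizer_def by auto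
next
  assume "weak_local_maximizer T a b xa xb K k L xt"
  then show thesis using that[of "- 1"] unfolding weak_local_maximizer_def by auto
qed

text \<open>At most one point is left, and the value there can serve as the constant. So normality
  excludes a degenerate segment.\<close>

lemma extremal_for_trivial:
  assumes "a \<ge> b"
  shows "extremal_for T a b P' g gy gv x"
proof -
  have "determined_points T a b \<subseteq> {a}"
    using assms by (auto simp: determined_points_def ts_interval_def)
  then show ?thesis unfolding extremal_for_def by blast
qed

text \<open>A delta derivative at \<open>t\<close> involves the value at the jump of
  \<open>t\<close>. The condition on \<open>forward_jump T t\<close> ensures that the integrated
  equation governs this value; it fails only at the last point of
  \<open>kappa (ts_interval T a b)\<close>, and only when \<open>b\<close> is not a determined
  point. The integrated equation makes the combination delta differentiable, but not its single
  terms; the second conjunct splits the derivative where these are differentiable too.\<close>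

theorem theorem4p3:
  fixes T :: "real set" and A B a b xa xb k :: real
    and H :: "real ^ 'n::finite \<Rightarrow> real" and H' :: "'n \<Rightarrow> real ^ 'n \<Rightarrow> real"
    and P :: "real ^ 'm::finite \<Rightarrow> real" and P' :: "'m \<Rightarrow> real ^ 'm \<Rightarrow> real"
    and f fy fv :: "'n \<Rightarrow> real \<Rightarrow> real \<Rightarrow> real \<Rightarrow> real"
    and g gy gv :: "'m \<Rightarrow> real \<Rightarrow> real \<Rightarrow> real \<Rightarrow> real"
    and L K :: "(real \<Rightarrow> real) \<Rightarrow> real"
    and xt :: "real \<Rightarrow> real"
  assumes "time_scale T" and "A \<in> T" and "B \<in> T" and "A < B"
    and "a \<in> T" and "b \<in> T" and "A \<le> a" and "a \<le> b" and "b < B"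
    and "has_continuous_partials H H'"
    and "has_continuous_partials P P'"
    and "\<And>i. regular_integrand T a b (f i) (fy i) (fv i)"
    and "\<And>j. regular_integrand T a b (g j) (gy j) (gv j)"
    and "\<And>x. L x = H (integral_functionals T a b f x)"
    and "\<And>x. K x = P (integral_functionals T a b g x)"
    and "extremizer T a b xa xb K k L xt"
    and "\<not> extremal_for T a b P' g gy gv xt"
  shows "\<exists>mu::real. \<forall>t \<in> kappa (ts_interval T a b). forward_jump T t \<in> determined_points T a b \<longrightarrow>
    has_delta_derivative (ts_interval T a b)
      (\<lambda>s. (\<Sum>i\<in>UNIV. H' i (integral_functionals T a b f xt) * along T xt (fv i) s)
         - mu * (\<Sum>j\<in>UNIV. P' j (integral_functionals T a b g xt) * along T xt (gv j) s))
      ((\<Sum>i\<in>UNIV. H' i (integral_functionals T a b f xt) * along T xt (fy i) t)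
         - mu * (\<Sum>j\<in>UNIV. P' j (integral_functionals T a b g xt) * along T xt (gy j) t)) t
    \<and> ((\<forall>i. delta_differentiable (ts_interval T a b) (along T xt (fv i)) t) \<and>
       (\<forall>j. delta_differentiable (ts_interval T a b) (along T xt (gv j)) t) \<longrightarrow>
         (\<Sum>i\<in>UNIV. H' i (integral_functionals T a b f xt) *
            (delta_deriv (ts_interval T a b) (along T xt (fv i)) t - along T xt (fy i) t))
       - mu * (\<Sum>j\<in>UNIV. P' j (integral_functionals T a b g xt) *
            (delta_deriv (ts_interval T a b) (along T xt (gv j)) t - along T xt (gy j) t)) = 0)"
proof -
  note HP = assms(10,11) and f = assms(12) and g = assms(13) and L = assms(14) and K = assms(15)
  have "a < b" using extremal_for_trivial[of b a T P' g gy gv xt] assms(17) by force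
  interpret time_scale_segment T a b B
    using assms \<open>a < b\<close> by unfold_locales (auto simp: time_scale_def)
  obtain s :: real and \<delta> where s: "\<bar>s\<bar> = 1" and adm: "admissible T a b xa xb K k xt" and "\<delta> > 0"
    and opt: "\<And>x. admissible T a b xa xb K k x \<Longrightarrow> c1_norm T a b (\<lambda>t. x t - xt t) < \<delta> \<Longrightarrow> s * L xt \<le> s * L x"
    using extremizerE[OF assms(16)] by blast
  have xt: "xt \<in> C1rd T" "xt a = xa" "xt b = xb" "K xt = k" using adm by (auto simp: admissible_def)
  define HL where "HL i = H' i (integral_functionals T a b f xt)" for i
  define PK where "PK j = P' j (integral_functionals T a b g xt)" for j
  define pL where "pL t = (\<Sum>i\<in>UNIV. HL i * along T xt (fy i) t)" for t
  define qL where "qL t = (\<Sum>i\<in>UNIV. HL i * along T xt (fv i) t)" for t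
  define pK where "pK t = (\<Sum>j\<in>UNIV. PK j * along T xt (gy j) t)" for t
  define qK where "qK t = (\<Sum>j\<in>UNIV. PK j * along T xt (gv j) t)" for t
  let ?dL = "composite_variation H' f fy fv xt" and ?dK = "composite_variation P' g gy gv xt"
  have rdf: "rd (along T xt (fy i))" "rd (along T xt (fv i))" for i
    using f[of i] xt(1) unfolding regular_integrand_def by blast+
  have rdg: "rd (along T xt (gy j))" "rd (along T xt (gv j))" for j
    using g[of j] xt(1) unfolding regular_integrand_def by blast+
  have rds: "rd pL" "rd qL" "rd pK" "rd qK"
    unfolding pL_def[abs_def] qL_def[abs_def] pK_def[abs_def] qK_def[abs_def]
    by (intro rd_continuous_on_sum rd_continuous_on_mult rd_continuous_on_const rdf rdg)+
  have dL: "?dL \<eta> = delta_integral T a b (\<lambda>t. pL t * \<eta> (\<sigma> t) + qL t * delta_deriv T \<eta> t)"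
    and dK: "?dK \<eta> = delta_integral T a b (\<lambda>t. pK t * \<eta> (\<sigma> t) + qK t * delta_deriv T \<eta> t)"
    if "\<eta> \<in> C1rd T" for \<eta>
    unfolding pL_def qL_def pK_def qK_def HL_def PK_def
    using composite_variation_eq[where f = f and fy = fy and fv = fv, OF f xt(1) that]
      composite_variation_eq[where f = g and fy = gy and fv = gv, OF g xt(1) that] by auto
  have "\<not> (\<exists>c. \<forall>t\<in>determined_points T a b. qK t - delta_integral T a t pK = c)"
  proof -
    have "qK t - delta_integral T a t pK
        = (\<Sum>j\<in>UNIV. PK j * (along T xt (gv j) t - delta_integral T a t (along T xt (gy j))))"
      if "t \<in> determined_points T a b" for t
      unfolding qK_def pK_def[abs_def] delta_integral_sum[OF rdg(1) determined_pointsD(1)[OF that]]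
      by (simp add: right_diff_distrib sum_subtractf)
    then show ?thesis using assms(17) unfolding extremal_for_def PK_def by auto
  qed
  then obtain \<eta>2 where \<eta>2: "\<eta>2 \<in> C1rd T" "\<eta>2 a = 0" "\<eta>2 b = 0" "?dK \<eta>2 \<noteq> 0"
    using du_Bois_Reymond[OF rds(3,4)] dK by metis
  define mu where "mu = ?dL \<eta>2 / ?dK \<eta>2"
  have multiplier: "?dL \<eta> = mu * ?dK \<eta>" if \<eta>: "\<eta> \<in> C1rd T" "\<eta> a = 0" "\<eta> b = 0" for \<eta>
  proof -
    let ?x = "perturb xt \<eta> \<eta>2"
    obtain d where d: "d > 0" "\<And>p. norm p < d \<Longrightarrow> c1_norm T a b (\<lambda>t. ?x p t - xt t) < \<delta>"
      using perturb_c1_norm[OF xt(1) \<eta>(1) \<eta>2(1) \<open>\<delta> > 0\<close>] by blast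
    \<comment> \<open>The sign \<open>s\<close> turns a maximizer of \<open>L\<close> into a
      minimizer of \<open>s * L\<close>, so one multiplier rule covers both cases; it cancels
      afterwards.\<close>
    have "s * ?dL \<eta> = s * ?dL \<eta>2 / ?dK \<eta>2 * ?dK \<eta>"
    proof (rule planar_lagrange[of "\<lambda>p. s * L (?x p)" _ _ "\<lambda>p. K (?x p)" _ _ d])
      show "((\<lambda>p. s * L (?x p)) has_derivative (\<lambda>p. fst p * (s * ?dL \<eta>) + snd p * (s * ?dL \<eta>2))) (at 0)"
        using has_derivative_mult_right[OF
            composite_has_derivative[where f = f and fy = fy and fv = fv, OF HP(1) f xt(1) \<eta>(1) \<eta>2(1)], of s]
        unfolding L by (simp add: algebra_simps)
      show "((\<lambda>p. K (?x p)) has_derivative (\<lambda>p. fst p * ?dK \<eta> + snd p * ?dK \<eta>2)) (at 0)"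
        unfolding K by (rule composite_has_derivative[OF HP(2) g xt(1) \<eta>(1) \<eta>2(1)])
      show "isCont (\<lambda>p. K (?x p)) p" for p
        unfolding K by (rule composite_continuous[OF HP(2) g xt(1) \<eta>(1) \<eta>2(1)])
      fix p assume p: "norm p < d" "K (?x p) = K (?x 0)"
      have "admissible T a b xa xb K k (?x p)"
        using p(2) xt \<eta> \<eta>2 perturb_C1rd(1)[OF xt(1) \<eta>(1) \<eta>2(1)]
        unfolding admissible_def perturb_0 by (simp add: perturb_def)
      from opt[OF this d(2)[OF p(1)]] show "s * L (?x 0) \<le> s * L (?x p)" unfolding perturb_0 .
    qed (fact \<eta>2 d)+
    then have "s * ?dL \<eta> = s * (mu * ?dK \<eta>)" by (simp add: mu_def)
    moreover have "s \<noteq> 0" using s by auto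
    ultimately show ?thesis by simp
  qed
  define p where "p t = 1 * pL t + (- mu) * pK t" for t
  define q where "q t = 1 * qL t + (- mu) * qK t" for t
  have rdpq: "rd p" "rd q" unfolding p_def[abs_def] q_def[abs_def] by (intro rd_continuous_on_lincomb rds)+
  obtain c where c: "\<And>t. t \<in> determined_points T a b \<Longrightarrow> q t - delta_integral T a t p = c"
  proof -
    have "delta_integral T a b (\<lambda>t. p t * \<eta> (\<sigma> t) + q t * delta_deriv T \<eta> t) = 0"
      if \<eta>: "\<eta> \<in> C1rd T" "\<eta> a = 0" "\<eta> b = 0" for \<eta>
    proof -
      have rdL: "rd (\<lambda>t. pL t * \<eta> (\<sigma> t) + qL t * delta_deriv T \<eta> t)"
        and rdK: "rd (\<lambda>t. pK t * \<eta> (\<sigma> t) + qK t * delta_deriv T \<eta> t)"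
        by (intro rd_continuous_on_add rd_continuous_on_mult rds C1rdD(2,3)[OF \<eta>(1)])+
      have "(\<lambda>t. p t * \<eta> (\<sigma> t) + q t * delta_deriv T \<eta> t)
          = (\<lambda>t. 1 * (pL t * \<eta> (\<sigma> t) + qL t * delta_deriv T \<eta> t)
              + (- mu) * (pK t * \<eta> (\<sigma> t) + qK t * delta_deriv T \<eta> t))"
        by (simp add: p_def q_def fun_eq_iff algebra_simps)
      then have "delta_integral T a b (\<lambda>t. p t * \<eta> (\<sigma> t) + q t * delta_deriv T \<eta> t)
          = 1 * ?dL \<eta> + (- mu) * ?dK \<eta>"
        using delta_integral_lincomb[OF rdL rdK bS, of 1 "- mu"] dL[OF \<eta>(1)] dK[OF \<eta>(1)] by simp
      then show ?thesis using multiplier[OF \<eta>] by simp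
    qed
    from du_Bois_Reymond[OF rdpq this] show thesis using that by blast
  qed
  obtain Y where Y: "\<And>s. s \<in> S \<Longrightarrow> has_delta_derivative T Y (p s) s"
      "\<And>t. t \<in> S \<Longrightarrow> delta_integral T a t p = Y t - Y a"
    using rd_antiderivative[OF rdpq(1)] by metis
  have qY: "q t = Y t + (c - Y a)" if "t \<in> determined_points T a b" for t
    using c[OF that] Y(2)[OF determined_pointsD(1)[OF that]] by simp
  show ?thesis
  proof (intro exI[of _ mu] ballI impI conjI)
    fix t assume "t \<in> kappa S" "\<sigma> t \<in> determined_points T a b"
    have "t \<in> S" using \<open>t \<in> kappa S\<close> kappa_subset by blast
    \<comment> \<open>For \<open>t = b\<close>, membership of \<open>\<sigma> b\<close> in
      \<open>S\<close> forces \<open>\<sigma> b = b\<close>, so the hypothesis on the jump speaks of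
      \<open>b\<close> itself.\<close>
    have t: "t \<in> determined_points T a b"
    proof (cases "t < b")
      case True
      then show ?thesis using \<open>t \<in> S\<close> by (simp add: determined_points_def)
    next
      case False
      then have "t = b" "\<sigma> b = b"
        using \<open>t \<in> S\<close> determined_pointsD(1)[OF \<open>\<sigma> t \<in> determined_points T a b\<close>] forward_jump_ge[of t T]
        by (auto simp: S_iff)
      then show ?thesis using \<open>\<sigma> t \<in> determined_points T a b\<close> by simp
    qed
    \<comment> \<open>A derivative needs the integrated equation on a neighbourhood of
      \<open>t\<close> in \<open>S\<close>. If \<open>b\<close> is not determined, then
      \<open>t < b\<close>, and the neighbourhood is chosen to avoid \<open>b\<close>.\<close>
    have near: "\<exists>r>0. \<forall>s\<in>S. \<bar>s - t\<bar> < r \<longrightarrow> s \<in> determined_points T a b"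
    proof (cases "b \<in> determined_points T a b")
      case True
      then show ?thesis by (auto simp: determined_points_def intro: exI[of _ 1])
    next
      case False
      then have "t < b" using t \<open>t \<in> S\<close> by (cases "t = b") (auto simp: S_iff)
      then show ?thesis by (intro exI[of _ "b - t"]) (auto simp: determined_points_def)
    qed
    have Dq: "has_delta_derivative S q (p t) t"
      unfolding has_delta_derivative_def
    proof (intro conjI allI impI)
      fix \<epsilon> :: real assume "\<epsilon> > 0"
      from has_delta_derivativeD[OF has_delta_derivative_restrict[OF Y(1)[OF \<open>t \<in> S\<close>] t] this]
      obtain r where r: "r > 0" "\<And>s. s \<in> S \<Longrightarrow> \<bar>s - t\<bar> < r \<Longrightarrow>
        \<bar>Y (forward_jump S t) - Y s - p t * (forward_jump S t - s)\<bar> \<le> \<epsilon> * \<bar>forward_jump S t - s\<bar>"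
        by blast
      obtain r' where r': "r' > 0" "\<And>s. s \<in> S \<Longrightarrow> \<bar>s - t\<bar> < r' \<Longrightarrow> s \<in> determined_points T a b"
        using near by blast
      \<comment> \<open>Here the hypothesis on \<open>\<sigma> t\<close> is used: \<open>q\<close>
        and \<open>Y\<close> differ by the same constant at the jump as near \<open>t\<close>, so
        \<open>q\<close> inherits the delta derivative \<open>p t\<close>.\<close>
      have "q (forward_jump S t) = Y (forward_jump S t) + (c - Y a)"
        unfolding determined_pointsD(3)[OF t] by (rule qY) fact
      then show "\<exists>d>0. \<forall>s\<in>S. \<bar>s - t\<bar> < d \<longrightarrow>
          \<bar>q (forward_jump S t) - q s - p t * (forward_jump S t - s)\<bar> \<le> \<epsilon> * \<bar>forward_jump S t - s\<bar>"
        using r r' qY by (intro exI[of _ "min r r'"]) auto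
    qed fact
    then show "has_delta_derivative S
        (\<lambda>s. (\<Sum>i\<in>UNIV. H' i (integral_functionals T a b f xt) * along T xt (fv i) s)
           - mu * (\<Sum>j\<in>UNIV. P' j (integral_functionals T a b g xt) * along T xt (gv j) s))
        ((\<Sum>i\<in>UNIV. H' i (integral_functionals T a b f xt) * along T xt (fy i) t)
           - mu * (\<Sum>j\<in>UNIV. P' j (integral_functionals T a b g xt) * along T xt (gy j) t)) t"
      by (simp add: p_def q_def[abs_def] pL_def qL_def pK_def qK_def HL_def PK_def)
    assume diff: "(\<forall>i. delta_differentiable S (along T xt (fv i)) t) \<and>
      (\<forall>j. delta_differentiable S (along T xt (gv j)) t)"
    have "has_delta_derivative S (along T xt (fv i)) (delta_deriv S (along T xt (fv i)) t) t" for i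
      using diff delta_deriv_S unfolding delta_differentiable_def by blast
    moreover have "has_delta_derivative S (along T xt (gv j)) (delta_deriv S (along T xt (gv j)) t) t" for j
      using diff delta_deriv_S unfolding delta_differentiable_def by blast
    \<comment> \<open>Differentiating \<open>q\<close> term by term gives a second value for its
      derivative; uniqueness equates it with \<open>p t\<close>, which is the equation in its usual
      form.\<close>
    ultimately have "has_delta_derivative S q
        (1 * (\<Sum>i\<in>UNIV. HL i * delta_deriv S (along T xt (fv i)) t)
          + (- mu) * (\<Sum>j\<in>UNIV. PK j * delta_deriv S (along T xt (gv j)) t)) t"
      unfolding q_def[abs_def] qL_def qK_def
      by (intro has_delta_derivative_lincomb has_delta_derivative_sum \<open>t \<in> kappa S\<close>)
    from has_delta_derivative_S_unique[OF this Dq]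
    show "(\<Sum>i\<in>UNIV. H' i (integral_functionals T a b f xt) *
            (delta_deriv S (along T xt (fv i)) t - along T xt (fy i) t))
       - mu * (\<Sum>j\<in>UNIV. P' j (integral_functionals T a b g xt) *
            (delta_deriv S (along T xt (gv j)) t - along T xt (gy j) t)) = 0"
      by (simp add: p_def pL_def pK_def HL_def PK_def right_diff_distrib sum_subtractf)
  qed
qed

end
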